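(* Let $n \ge 1$ and let $\mu$ be a symmetric probability measure on the free group $F_m = \langle a_1^{\pm1},\dots,a_m^{\pm 1}\rangle$ (that is, $\mu(g)=\mu(g^{-1})$ for all $g\in F_m$) such that $$\operatorname{supp}(\mu) = \{ a_i^j : 1 \le i \le m,\ 1 \le |j| \le n \}.$$ Consider the random walk on $F_m$ generated by $\mu$, and let $\nu$ be the corresponding hitting measure on $\partial F_m$. Then for every $1\le i\le m$, $$\rho_{\mu}(a_i) \ge \frac{\nu(C(a_i))}{1 - \nu(C(a_i))}.$$
   Context: $F_m$ is the free group on $a_1,\dots,a_m$. The random walk generated by $\mu$ is $X_{k+1}=X_k s_{k+1}$ with $s_1,s_2,\dots$ i.i.d. of law $\mu$; $\mathbb P_x$ denotes its law when $X_0=x$. Standing assumption: the walk is transient. Almost every sample path started at $e$ converges to a point of the boundary $\partial F_m$ (the space of infinite reduced words, equivalently geodesic rays in the Cayley tree starting from $e$); the hitting measure $\nu$ is the law of the limit point. For $g\in F_m$, the cylinder set $C(g)\subset\partial F_m$ is the set of geodesic rays starting from the identity and containing $g$. First-passage function: $F_\mu(x,y)=\sum_{k\ge 0}\mathbb P_x(X_k=y,\ X_j\ne y \text{ for } j<k)$ (so $F_\mu(x,x)=1$). Furthermore $\rho_\mu(g):=\liminf_{k\to\infty}F_\mu(e,g^k)^{1/k}$. *)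

theory Defs
  imports "HOL-Probability.Probability" "HOL-Algebra.Group"
begin

section \<open>The free group on \<open>a\<^sub>1, \<dots>, a\<^sub>m\<close> as the group of reduced words\<close>

text \<open>The letter \<open>(i, True)\<close> is \<open>a\<^sub>i\<close> and \<open>(i, False)\<close> is its formal inverse.\<close>

type_synonym letter = "nat \<times> bool"

definition inv_letter :: "letter \<Rightarrow> letter" where
  "inv_letter x = (fst x, \<not> snd x)"

definition reduced :: "letter list \<Rightarrow> bool" where
  "reduced w = successively (\<lambda>x y. y \<noteq> inv_letter x) w"

definition cons_red :: "letter \<Rightarrow> letter list \<Rightarrow> letter list" where
  "cons_red x w = (case w of [] \<Rightarrow> [x] | y # ys \<Rightarrow> if y = inv_letter x then ys else x # w)"

definition free_group :: "nat \<Rightarrow> letter list monoid" where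
  "free_group m =
     \<lparr>carrier = {w. reduced w \<and> fst ` set w \<subseteq> {1..m}},
      mult = (\<lambda>u v. foldr cons_red u v),
      one = []\<rparr>"

definition gen :: "nat \<Rightarrow> letter list" where
  "gen i = [(i, True)]"

lemma inv_letter_inv_letter [simp]: "inv_letter (inv_letter x) = x"
  by (simp add: inv_letter_def)

lemma fst_inv_letter [simp]: "fst (inv_letter x) = fst x"
  by (simp add: inv_letter_def)

lemma reduced_Nil [simp]: "reduced []"
  by (simp add: reduced_def)

lemma reduced_cons_red: "reduced w \<Longrightarrow> reduced (cons_red x w)"
  by (cases w) (auto simp: cons_red_def reduced_def successively_Cons)

lemma reduced_foldr_cons_red: "reduced w \<Longrightarrow> reduced (foldr cons_red u w)"
  by (induction u) (auto intro: reduced_cons_red)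

lemma cons_red_inv_letter: "reduced w \<Longrightarrow> cons_red x (cons_red (inv_letter x) w) = w"
  by (cases w) (auto simp: cons_red_def reduced_def successively_Cons split: list.splits)

lemma foldr_cons_red_cons_red:
  "reduced w \<Longrightarrow> foldr cons_red (cons_red x z) w = cons_red x (foldr cons_red z w)"
  by (cases z)
    (auto simp: cons_red_inv_letter reduced_foldr_cons_red cons_red_def[of x "_ # _"] cons_red_def[of x "[]"])

lemma foldr_cons_red_assoc:
  "reduced w \<Longrightarrow> foldr cons_red (foldr cons_red u v) w = foldr cons_red u (foldr cons_red v w)"
  by (induction u) (simp_all add: foldr_cons_red_cons_red)

lemma foldr_cons_red_Nil: "reduced w \<Longrightarrow> foldr cons_red w [] = w"
  by (induction w) (auto simp: cons_red_def reduced_def successively_Cons split: list.splits)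

lemma set_foldr_cons_red: "set (foldr cons_red u w) \<subseteq> set u \<union> set w"
proof (induction u)
  case (Cons x u)
  have "set (cons_red x z) \<subseteq> insert x (set z)" for z
    by (cases z) (auto simp: cons_red_def)
  with Cons show ?case by fastforce
qed simp

lemma foldr_cons_red_inverse:
  "foldr cons_red (rev (map inv_letter w)) w = []"
proof (induction w)
  case (Cons x w)
  have "cons_red (inv_letter x) (x # w) = w" by (simp add: cons_red_def)
  with Cons show ?case by simp
qed simp

lemma reduced_inverse: "reduced w \<Longrightarrow> reduced (rev (map inv_letter w))"
  by (auto simp: reduced_def successively_rev successively_map elim!: successively_mono)
     
lemma group_free_group: "group (free_group m)"
proof (rule groupI)
  fix x y assume "x \<in> carrier (free_group m)" "y \<in> carrier (free_group m)"
  then show "x \<otimes>\<^bsub>free_group m\<^esub> y \<in> carrier (free_group m)"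
    using set_foldr_cons_red[of x y]
    by (fastforce simp: free_group_def intro: reduced_foldr_cons_red)
next
  fix x assume x: "x \<in> carrier (free_group m)"
  then have "rev (map inv_letter x) \<in> carrier (free_group m)"
    by (auto simp: free_group_def reduced_inverse)
  then show "\<exists>y\<in>carrier (free_group m). y \<otimes>\<^bsub>free_group m\<^esub> x = \<one>\<^bsub>free_group m\<^esub>"
    by (intro bexI[of _ "rev (map inv_letter x)"])
       (simp_all add: free_group_def foldr_cons_red_inverse)
qed (auto simp: free_group_def foldr_cons_red_assoc)


section \<open>The random walk and its first-passage function\<close>

text \<open>The coordinate \<open>s k\<close> is the increment from time \<open>k\<close> to time \<open>k + 1\<close>.\<close>

definition steps :: "letter list pmf \<Rightarrow> (nat \<Rightarrow> letter list) measure" where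
  "steps \<mu> = (\<Pi>\<^sub>M k\<in>UNIV. measure_pmf \<mu>)"

primrec walk :: "nat \<Rightarrow> letter list \<Rightarrow> (nat \<Rightarrow> letter list) \<Rightarrow> nat \<Rightarrow> letter list" where
  "walk m x s 0 = x"
| "walk m x s (Suc k) = walk m x s k \<otimes>\<^bsub>free_group m\<^esub> s k"

text \<open>Finiteness of the Green function at the identity; by homogeneity of the walk the starting
  point is immaterial.\<close>

definition transient :: "nat \<Rightarrow> letter list pmf \<Rightarrow> bool" where
  "transient m \<mu> \<longleftrightarrow>
     summable (\<lambda>k. \<P>(s in steps \<mu>. walk m \<one>\<^bsub>free_group m\<^esub> s k = \<one>\<^bsub>free_group m\<^esub>))"

definition first_passage ::
    "nat \<Rightarrow> letter list pmf \<Rightarrow> letter list \<Rightarrow> letter list \<Rightarrow> real" where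
  "first_passage m \<mu> x y =
     (\<Sum>k. \<P>(s in steps \<mu>. walk m x s k = y \<and> (\<forall>j<k. walk m x s j \<noteq> y)))"

definition rho :: "nat \<Rightarrow> letter list pmf \<Rightarrow> letter list \<Rightarrow> ereal" where
  "rho m \<mu> g = liminf (\<lambda>k. ereal
     (root k (first_passage m \<mu> \<one>\<^bsub>free_group m\<^esub> (g [^]\<^bsub>free_group m\<^esub> k))))"


section \<open>The boundary and the hitting measure\<close>

definition boundary :: "nat \<Rightarrow> (nat \<Rightarrow> letter) set" where
  "boundary m = {\<xi>. \<forall>k. fst (\<xi> k) \<in> {1..m} \<and> \<xi> (Suc k) \<noteq> inv_letter (\<xi> k)}"

text \<open>A geodesic ray from the identity passes through \<open>g\<close> iff the reduced word \<open>g\<close> is an initial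
  segment of the ray.\<close>

definition cylinder :: "nat \<Rightarrow> letter list \<Rightarrow> (nat \<Rightarrow> letter) set" where
  "cylinder m g = {\<xi> \<in> boundary m. map \<xi> [0..<length g] = g}"

text \<open>The cylinders are a countable base of the topology, so they generate the Borel sets.\<close>

definition boundary_algebra :: "nat \<Rightarrow> (nat \<Rightarrow> letter) measure" where
  "boundary_algebra m = sigma (boundary m) (cylinder m ` carrier (free_group m))"

definition converges_to :: "(nat \<Rightarrow> letter list) \<Rightarrow> (nat \<Rightarrow> letter) \<Rightarrow> bool" where
  "converges_to X \<xi> \<longleftrightarrow> (\<forall>l. \<forall>\<^sub>F k in sequentially. take l (X k) = map \<xi> [0..<l])"

text \<open>Paths without a limit, a null set in the transient case, are sent to the arbitrary boundary
  point \<open>a\<^sub>1 a\<^sub>1 a\<^sub>1 \<dots>\<close>.\<close>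

definition limit_point :: "nat \<Rightarrow> (nat \<Rightarrow> letter list) \<Rightarrow> (nat \<Rightarrow> letter)" where
  "limit_point m X =
     (if \<exists>\<xi>\<in>boundary m. converges_to X \<xi>
      then THE \<xi>. \<xi> \<in> boundary m \<and> converges_to X \<xi>
      else (\<lambda>_. (1, True)))"

definition hitting_measure :: "nat \<Rightarrow> letter list pmf \<Rightarrow> (nat \<Rightarrow> letter) measure" where
  "hitting_measure m \<mu> =
     distr (steps \<mu>) (boundary_algebra m) (\<lambda>s. limit_point m (walk m \<one>\<^bsub>free_group m\<^esub> s))"

end

theory Submission
  imports Defs
begin

text \<open>Write \<open>a = a\<^sub>i\<close>, let the axis be the subgroup of all powers of \<open>a\<close>, and let \<open>F(g)\<close> be the
  probability that the walk from \<open>e\<close> ever visits \<open>g\<close>. The proof locates the limit point by the place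
  where the walk leaves the axis for good.

  Every step is a power of a single generator, so an excursion away from the axis can only come back
  to the point of the axis from which it started: the projection of the walk to the axis moves only
  during steps inside the axis (\<open>proj_walk_Suc\<close>). Almost surely the walk converges to the boundary
  (\<open>AE_settles\<close>) and visits the axis only finitely often (\<open>finite_visits_axis\<close>). After the last visit, at
  \<open>a\<^sup>j\<close> say, the projection stays at \<open>a\<^sup>j\<close>, so a limit point in \<open>C(a)\<close> forces \<open>j \<ge> 1\<close>.

  By the strong Markov property at the first visit to \<open>a\<^sup>j\<close>, the last visit is at \<open>a\<^sup>j\<close> with probability
  \<open>F(a\<^sup>j) K\<close>, where \<open>K > 0\<close> is the probability that it is at \<open>e\<close> (\<open>pr_last_visit\<close>,
  \<open>last_visit_Nil_pos\<close>). The automorphism inverting all generators preserves the step law, so \<open>a\<^sup>j\<close> and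
  its inverse are equally likely. With \<open>S\<close> the sum of \<open>F(a\<^sup>j)\<close> over \<open>j \<ge> 1\<close> and
  \<open>p = \<nu>(C(a))\<close> this gives \<open>p \<le> K S\<close> and \<open>K (1 + 2 S) \<le> 1\<close>.

  Finally \<open>F\<close> is supermultiplicative, because the walk may first visit \<open>g\<close> and then move on by \<open>h\<close>.
  Hence \<open>F(a\<^sup>j) \<le> \<rho>\<^sup>j\<close> as in Fekete's lemma (\<open>root_le_liminf_root\<close>). If \<open>\<rho> < 1\<close>, then
  \<open>S \<le> \<rho> / (1 - \<rho>)\<close>, and the two bounds on \<open>p\<close> yield \<open>p (1 + \<rho>) \<le> \<rho>\<close>, which is the claim. If
  \<open>\<rho> \<ge> 1\<close>, it suffices that \<open>p \<le> 1/2\<close> (\<open>odds_le_of_geometric_bound\<close>).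

  Positivity of \<open>K\<close> and finiteness of the visits to the axis rest on transience. If the walk returned
  to the axis almost surely, then after a first step \<open>b\<close> by another generator it would return to \<open>e\<close>
  almost surely; by the inverting automorphism it would also hit \<open>b\<close> almost surely, and so
  return to \<open>e\<close> almost surely (\<open>no_return_axis_pos\<close>). Another generator exists because a symmetric
  walk with bounded steps on the integers is recurrent (\<open>rank_ge_two\<close>).\<close>


section \<open>Multiplication by reduced words and projection to the powers of a generator\<close>

abbreviation mult_word :: "letter list \<Rightarrow> letter list \<Rightarrow> letter list" (infixl "\<odot>" 70) where
  "u \<odot> v \<equiv> foldr cons_red u v"

text \<open>On words this is not inversion, which would also reverse the order, but the automorphism that
  sends every generator to its inverse; on powers of a single generator the two agree.\<close>

abbreviation flip :: "letter list \<Rightarrow> letter list" where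
  "flip \<equiv> map inv_letter"

text \<open>The reduced words of the axis are the powers of the generator (\<open>reduced_axisD\<close>). Describing them
  letter by letter avoids a case distinction on the sign of the exponent.\<close>

definition axis :: "nat \<Rightarrow> letter list set" where
  "axis i = {w. \<forall>x\<in>set w. fst x = i}"

lemma mult_free_group [simp]: "x \<otimes>\<^bsub>free_group m\<^esub> y = x \<odot> y"
  and one_free_group [simp]: "\<one>\<^bsub>free_group m\<^esub> = []"
  by (simp_all add: free_group_def)

lemma carrier_free_group: "w \<in> carrier (free_group m) \<longleftrightarrow> reduced w \<and> fst ` set w \<subseteq> {1..m}"
  by (simp add: free_group_def)

lemma inv_letter_neq [simp]: "inv_letter x \<noteq> x" "x \<noteq> inv_letter x"
  by (auto simp: inv_letter_def prod_eq_iff)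

lemma inv_letter_eq_iff [simp]: "inv_letter x = inv_letter y \<longleftrightarrow> x = y"
  by (auto simp: inv_letter_def prod_eq_iff)

lemma flip_flip: "flip (flip w) = w"
  by (induction w) auto

lemma flip_eq_iff: "flip u = v \<longleftrightarrow> u = flip v"
  using flip_flip by metis

lemma flip_cons_red: "flip (cons_red x w) = cons_red (inv_letter x) (flip w)"
  by (cases w) (auto simp: cons_red_def)

lemma flip_mult: "flip (u \<odot> v) = flip u \<odot> flip v"
  by (induction u) (auto simp: flip_cons_red)

lemma flip_axis [simp]: "flip w \<in> axis i \<longleftrightarrow> w \<in> axis i"
  by (auto simp: axis_def)

lemma reduced_replicate: "reduced (replicate r x)"
proof (induction r)
  case (Suc r)
  then show ?case by (cases r) (auto simp: reduced_def)
qed simp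

lemma replicate_carrier: "fst x \<in> {1..m} \<Longrightarrow> replicate r x \<in> carrier (free_group m)"
  by (auto simp: carrier_free_group reduced_replicate)

lemma reduced_axisD:
  assumes "reduced w" "w \<in> axis i"
  obtains r b where "w = replicate r (i, b)"
proof -
  have "\<exists>r b. w = replicate r (i, b)"
    using assms
  proof (induction w)
    case (Cons x w)
    then obtain r b where rb: "w = replicate r (i, b)"
      by (auto simp: axis_def reduced_def successively_Cons)
    obtain c where x: "x = (i, c)"
      using Cons.prems by (cases x) (auto simp: axis_def)
    show ?case
    proof (cases r)
      case 0
      then show ?thesis using rb x by (intro exI[of _ 1] exI[of _ c]) auto
    next
      case (Suc r')
      then have "c = b"
        using Cons.prems rb x by (auto simp: reduced_def inv_letter_def)
      then show ?thesis using rb x Suc by (intro exI[of _ "Suc r"] exI[of _ b]) auto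
    qed
  qed auto
  then show thesis using that by blast
qed

lemma replicate_axis [simp]: "replicate r (i, b) \<in> axis i"
  by (auto simp: axis_def)

lemma Nil_axis [simp]: "[] \<in> axis i"
  by (simp add: axis_def)

lemma axis_mult: "u \<in> axis i \<Longrightarrow> v \<in> axis i \<Longrightarrow> u \<odot> v \<in> axis i"
  using set_foldr_cons_red[of u v] by (auto simp: axis_def)

lemma mult_inverse_cancel: "reduced u \<Longrightarrow> reduced v \<Longrightarrow> rev (flip u) \<odot> (u \<odot> v) = v"
  by (simp flip: foldr_cons_red_assoc add: foldr_cons_red_inverse)

lemma axis_mult_iff:
  assumes "reduced u" "reduced v" "u \<in> axis i"
  shows "u \<odot> v \<in> axis i \<longleftrightarrow> v \<in> axis i"
proof
  assume "u \<odot> v \<in> axis i"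
  moreover have "rev (flip u) \<in> axis i"
    using assms(3) by (auto simp: axis_def)
  ultimately have "rev (flip u) \<odot> (u \<odot> v) \<in> axis i"
    using axis_mult by blast
  then show "v \<in> axis i"
    using mult_inverse_cancel[of u v] assms by metis
next
  assume "v \<in> axis i"
  then show "u \<odot> v \<in> axis i" using assms(3) axis_mult by blast
qed

lemma mult_left_cancel_iff:
  assumes "reduced u" "reduced v" "reduced w"
  shows "u \<odot> v = u \<odot> w \<longleftrightarrow> v = w"
  using assms mult_inverse_cancel by metis

text \<open>Left multiplication is the primitive operation of \<open>free_group\<close>, but the walk multiplies on the
  right. This computes the product with a single letter at the right end of a word, and
  \<open>mult_Cons_right\<close> reduces general products to it.\<close>

lemma mult_letter:
  assumes "reduced w"
  shows "w \<odot> [x] = (if w \<noteq> [] \<and> last w = inv_letter x then butlast w else w @ [x])"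
  using assms
proof (induction w)
  case (Cons y w)
  have IH: "w \<odot> [x] = (if w \<noteq> [] \<and> last w = inv_letter x then butlast w else w @ [x])"
    using Cons by (auto simp: reduced_def successively_Cons)
  have "(y # w) \<odot> [x] = cons_red y (w \<odot> [x])" by simp
  also have "\<dots> = (if last (y # w) = inv_letter x then butlast (y # w) else (y # w) @ [x])"
  proof (cases w)
    case Nil
    then show ?thesis by (auto simp: cons_red_def)
  next
    case (Cons z w')
    with \<open>reduced (y # w)\<close> have "z \<noteq> inv_letter y" by (simp add: reduced_def)
    then show ?thesis using Cons IH by (auto simp: cons_red_def)
  qed
  finally show ?case by simp
qed simp

lemma mult_Cons_right:
  assumes "reduced (x # v)"
  shows "w \<odot> (x # v) = (w \<odot> [x]) \<odot> v"
proof -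
  have "reduced v" and "[x] \<odot> v = x # v"
    using assms by (cases v; auto simp: reduced_def cons_red_def successively_Cons)+
  then show ?thesis
    using foldr_cons_red_assoc[of v w "[x]"] by simp
qed

lemma reduced_mult: "reduced v \<Longrightarrow> reduced (u \<odot> v)"
  by (rule reduced_foldr_cons_red)

lemma length_mult: "length (u \<odot> v) \<le> length u + length v"
proof (induction u)
  case (Cons x u)
  have "length (cons_red x w) \<le> Suc (length w)" for w
    by (cases w) (auto simp: cons_red_def)
  from this[of "u \<odot> v"] Cons show ?case by simp
qed simp

text \<open>A factor of length at most \<open>r\<close> cancels at most the last \<open>r\<close> letters. So a walk with bounded steps
  that stays far from the identity keeps its initial letters, which yields convergence.\<close>

lemma take_mult:
  assumes "reduced w" "reduced v" "l + length v \<le> length w"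
  shows "take l (w \<odot> v) = take l w"
  using assms
proof (induction v arbitrary: w)
  case Nil
  then show ?case by (simp add: foldr_cons_red_Nil)
next
  case (Cons x v)
  have red: "reduced v" using Cons.prems by (auto simp: reduced_def successively_Cons)
  have "reduced (w \<odot> [x])" by (rule reduced_mult) (simp add: reduced_def)
  moreover have "l + length v \<le> length (w \<odot> [x])"
    using Cons.prems by (auto simp: mult_letter)
  ultimately have "take l ((w \<odot> [x]) \<odot> v) = take l (w \<odot> [x])"
    using red by (intro Cons.IH)
  also have "\<dots> = take l w"
    using Cons.prems by (auto simp: mult_letter take_butlast)
  finally show ?case using Cons.prems by (simp add: mult_Cons_right)
qed

text \<open>For reduced \<open>w\<close> this is the point of the axis closest to \<open>w\<close> in the Cayley tree.\<close>

definition proj :: "nat \<Rightarrow> letter list \<Rightarrow> letter list" where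
  "proj i w = takeWhile (\<lambda>x. fst x = i) w"

lemma proj_axis: "w \<in> axis i \<Longrightarrow> proj i w = w"
  by (auto simp: axis_def proj_def takeWhile_eq_all_conv)

text \<open>Multiplication by a letter is a step along an edge of the Cayley tree. The only edges whose end
  points project differently are those of the axis itself. The second conclusion says that a letter
  of index \<open>i\<close> cannot lead back to the axis, which keeps the hypothesis alive when such letters are
  multiplied one after the other.\<close>

lemma proj_mult_letter:
  assumes "reduced w" "fst x \<noteq> i \<or> w \<notin> axis i"
  shows "proj i (w \<odot> [x]) = proj i w" "fst x = i \<Longrightarrow> w \<odot> [x] \<notin> axis i"
proof -
  have "proj i (w \<odot> [x]) = proj i w \<and> (fst x = i \<longrightarrow> w \<odot> [x] \<notin> axis i)"
  proof (cases "w \<noteq> [] \<and> last w = inv_letter x")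
    case True
    then obtain u where u: "w = u @ [inv_letter x]"
      by (metis append_butlast_last_id)
    have "w \<odot> [x] = u"
      using mult_letter[OF assms(1), of x] u by simp
    then show ?thesis
      using assms(2) u by (auto simp: axis_def proj_def takeWhile_append)
  next
    case False
    then have "w \<odot> [x] = w @ [x]"
      using mult_letter[OF assms(1), of x] by metis
    then show ?thesis
      using assms(2) 
      by (auto simp: axis_def proj_def takeWhile_append
          intro!: takeWhile_eq_all_conv[THEN iffD2, symmetric])
  qed
  then show "proj i (w \<odot> [x]) = proj i w" "fst x = i \<Longrightarrow> w \<odot> [x] \<notin> axis i"
    by auto
qed

lemma proj_mult_replicate:
  assumes "reduced w" "fst x \<noteq> i \<or> w \<notin> axis i"
  shows "proj i (w \<odot> replicate r x) = proj i w"
  using assms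
proof (induction r arbitrary: w)
  case 0
  then show ?case by (simp add: foldr_cons_red_Nil)
next
  case (Suc r)
  have "w \<odot> replicate (Suc r) x = (w \<odot> [x]) \<odot> replicate r x"
    using mult_Cons_right[of x "replicate r x" w] reduced_replicate[of "Suc r" x] by simp
  also have "proj i \<dots> = proj i (w \<odot> [x])"
    using Suc.prems proj_mult_letter(2)[of w x i]
    by (intro Suc.IH reduced_mult) (auto simp: reduced_def)
  also have "\<dots> = proj i w"
    using Suc.prems by (rule proj_mult_letter)
  finally show ?case .
qed

lemma gen_pow: "gen i [^]\<^bsub>free_group m\<^esub> (k::nat) = replicate k (i, True)"
proof (induction k)
  case 0
  then show ?case by (simp add: group.is_monoid[OF group_free_group] )
next
  case (Suc k)
  have "replicate k (i, True) \<odot> [(i, True)] = replicate k (i, True) @ [(i, True)]"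
    by (subst mult_letter[OF reduced_replicate]) (auto simp: inv_letter_def)
  then show ?case using Suc
    by (simp add: gen_def replicate_append_same)
qed

lemma inv_free_group:
  assumes "w \<in> carrier (free_group m)"
  shows "inv\<^bsub>free_group m\<^esub> w = rev (flip w)"
proof -
  interpret group "free_group m" by (rule group_free_group)
  show ?thesis
    using assms by (intro inv_equality)
      (auto simp: foldr_cons_red_inverse carrier_free_group reduced_inverse)
qed

lemma gen_int_pow:
  assumes "i \<in> {1..m}"
  shows "gen i [^]\<^bsub>free_group m\<^esub> (j::int) = replicate (nat \<bar>j\<bar>) (i, 0 \<le> j)"
proof -
  interpret group "free_group m" by (rule group_free_group)
  show ?thesis
    using replicate_carrier[of "(i, True)" m] assms
    by (auto simp: int_pow_def2 gen_pow inv_free_group inv_letter_def)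
qed

section \<open>Markov property of independent steps\<close>

abbreviation (input) shift :: "nat \<Rightarrow> (nat \<Rightarrow> 'a) \<Rightarrow> nat \<Rightarrow> 'a" where
  "shift t s \<equiv> \<lambda>k. s (t + k)"

abbreviation pr :: "letter list pmf \<Rightarrow> ((nat \<Rightarrow> letter list) \<Rightarrow> bool) \<Rightarrow> real" where
  "pr \<mu> Q \<equiv> measure (steps \<mu>) {s. Q s}"

lemma space_steps [simp]: "space (steps \<mu>) = UNIV"
  by (simp add: steps_def space_PiM PiE_UNIV_domain)

lemma prob_space_steps: "prob_space (steps \<mu>)"
  unfolding steps_def by (intro prob_space_PiM prob_space_measure_pmf)

lemma step_measurable: "(\<lambda>s. s k) \<in> measurable (steps \<mu>) (count_space UNIV)"
proof -
  have "(\<lambda>s. s k) \<in> measurable (steps \<mu>) (measure_pmf \<mu>)"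
    unfolding steps_def by (rule measurable_component_singleton) simp
  then show ?thesis
    by (simp add: measurable_cong_sets[OF refl sets_measure_pmf_count_space])
qed

lemma walk_measurable:
  "(\<lambda>s. walk m x s k) \<in> measurable (steps \<mu>) (count_space UNIV)"
proof (induction k)
  case (Suc k)
  have "(\<lambda>s. walk m x s k \<odot> s k) \<in> measurable (steps \<mu>) (count_space UNIV)"
    by (rule measurable_compose_countable[OF _ Suc])
       (rule measurable_compose[OF step_measurable], simp)
  then show ?case by simp
qed simp

lemma pred_walk: "Measurable.pred (steps \<mu>) (\<lambda>s. P (walk m x s k))"
  by (rule measurable_compose[OF walk_measurable]) simp

lemma measurable_steps:
  assumes "\<And>k. (\<lambda>s. f s k) \<in> measurable M (count_space UNIV)"
  shows "f \<in> measurable M (steps \<mu>)"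
  unfolding steps_def
proof (rule measurable_PiM_single')
  fix k
  show "(\<lambda>s. f s k) \<in> measurable M (measure_pmf \<mu>)"
    using assms by (simp add: measurable_cong_sets[OF refl sets_measure_pmf_count_space])
qed (auto simp: PiE_UNIV_domain)

lemma pred_sets_steps: "Measurable.pred (steps \<mu>) Q \<Longrightarrow> {s. Q s} \<in> sets (steps \<mu>)"
  by (simp add: pred_def)

lemma shift_measurable: "shift t \<in> measurable (steps \<mu>) (steps \<mu>)"
  by (intro measurable_steps step_measurable)

lemma pred_shift:
  "Measurable.pred (steps \<mu>) D \<Longrightarrow> Measurable.pred (steps \<mu>) (\<lambda>s. D (shift t s))"
  by (rule measurable_compose[OF shift_measurable])

lemma pred_walk_shift: "Measurable.pred (steps \<mu>) (\<lambda>s. P (walk m x (shift t s) k))"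
  by (rule pred_shift) (rule pred_walk)

lemmas path_event = pred_intros_countable pred_intros_logic pred_walk pred_walk_shift

lemma walk_cong: "(\<And>k. k < t \<Longrightarrow> s k = s' k) \<Longrightarrow> j \<le> t \<Longrightarrow> walk m x s j = walk m x s' j"
  by (induction j) auto

text \<open>Splicing two independent step sequences at time \<open>t\<close> gives a sequence of the same law; the past
  is read off from the first and the future is the second.\<close>

lemma markov_property:
  assumes [measurable]: "Measurable.pred (steps \<mu>) Q" "Measurable.pred (steps \<mu>) D"
    and past: "\<And>s s'. (\<And>k. k < t \<Longrightarrow> s k = s' k) \<Longrightarrow> Q s = Q s'"
  shows "pr \<mu> (\<lambda>s. Q s \<and> D (shift t s)) = pr \<mu> Q * pr \<mu> D"
proof -
  interpret sequence_space "measure_pmf \<mu>"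
    by standard
  have S: "S = steps \<mu>" by (simp add: steps_def)
  interpret St: prob_space "steps \<mu>" by (rule prob_space_steps)
  let ?A = "{s. Q s \<and> D (shift t s)}"
  let ?f = "\<lambda>(\<omega>, \<omega>'). comb_seq t \<omega> \<omega>'"
  have [measurable]: "Measurable.pred (steps \<mu>) (\<lambda>s. D (shift t s))"
    by (rule pred_shift) fact
  have A: "?A \<in> sets (steps \<mu>)"
    by (rule pred_sets_steps) measurable
  have comb: "?f \<in> measurable (steps \<mu> \<Otimes>\<^sub>M steps \<mu>) (steps \<mu>)"
    using measurable_comb_seq[of t "measure_pmf \<mu>"] by (simp add: S)
  have "emeasure (steps \<mu>) ?A = emeasure (distr (steps \<mu> \<Otimes>\<^sub>M steps \<mu>) (steps \<mu>) ?f) ?A"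
    using PiM_comb_seq[of t] by (simp add: S)
  also have "\<dots> = emeasure (steps \<mu> \<Otimes>\<^sub>M steps \<mu>) (?f -` ?A \<inter> space (steps \<mu> \<Otimes>\<^sub>M steps \<mu>))"
    by (rule emeasure_distr[OF comb A])
  also have "?f -` ?A \<inter> space (steps \<mu> \<Otimes>\<^sub>M steps \<mu>) = {s. Q s} \<times> {s. D s}"
  proof -
    have "Q (comb_seq t s s') = Q s" for s s'
      by (rule past) (simp add: comb_seq_def)
    moreover have "shift t (comb_seq t s s') = s'" for s s' :: "nat \<Rightarrow> letter list"
      by (simp add: comb_seq_def)
    ultimately show ?thesis by (auto simp: space_pair_measure)
  qed
  also have "emeasure (steps \<mu> \<Otimes>\<^sub>M steps \<mu>) \<dots> = emeasure (steps \<mu>) {s. Q s} * emeasure (steps \<mu>) {s. D s}"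
    by (rule St.emeasure_pair_measure_Times) (auto intro: pred_sets_steps)
  finally show ?thesis
    by (simp add: measure_def enn2real_mult)
qed

lemma sums_pr:
  assumes "\<And>t. Measurable.pred (steps \<mu>) (Q t)"
    and "\<And>s t u. Q t s \<Longrightarrow> Q u s \<Longrightarrow> t = (u::nat)"
  shows "(\<lambda>t. pr \<mu> (Q t)) sums pr \<mu> (\<lambda>s. \<exists>t. Q t s)"
proof -
  interpret prob_space "steps \<mu>" by (rule prob_space_steps)
  have "(\<lambda>t. pr \<mu> (Q t)) sums measure (steps \<mu>) (\<Union>t. {s. Q t s})"
    using assms by (intro finite_measure_UNION) (auto simp: disjoint_family_on_def intro: pred_sets_steps)
  also have "(\<Union>t. {s. Q t s}) = {s. \<exists>t. Q t s}" by auto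
  finally show ?thesis .
qed

text \<open>The event \<open>Q t\<close> says that a stopping time takes the value \<open>t\<close>, so it is decided by the steps before
  time \<open>t\<close> and holds for at most one \<open>t\<close>.\<close>

lemma strong_markov_property:
  assumes Q: "\<And>t. Measurable.pred (steps \<mu>) (Q t)" and D: "Measurable.pred (steps \<mu>) D"
    and past: "\<And>t s s'. (\<And>k. k < t \<Longrightarrow> s k = s' k) \<Longrightarrow> Q t s = Q t s'"
    and unique: "\<And>s t u. Q t s \<Longrightarrow> Q u s \<Longrightarrow> t = (u::nat)"
  shows "pr \<mu> (\<lambda>s. \<exists>t. Q t s \<and> D (shift t s)) = pr \<mu> (\<lambda>s. \<exists>t. Q t s) * pr \<mu> D"
proof -
  have "Measurable.pred (steps \<mu>) (\<lambda>s. Q t s \<and> D (shift t s))" for t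
    using Q D pred_shift by (intro pred_intros_logic) auto
  then have "(\<lambda>t. pr \<mu> (\<lambda>s. Q t s \<and> D (shift t s))) sums pr \<mu> (\<lambda>s. \<exists>t. Q t s \<and> D (shift t s))"
    using unique by (intro sums_pr) blast+
  moreover have "pr \<mu> (\<lambda>s. Q t s \<and> D (shift t s)) = pr \<mu> (Q t) * pr \<mu> D" for t
    using Q D past by (intro markov_property) blast+
  moreover have "(\<lambda>t. pr \<mu> (Q t) * pr \<mu> D) sums (pr \<mu> (\<lambda>s. \<exists>t. Q t s) * pr \<mu> D)"
    using Q unique by (intro sums_mult2 sums_pr) blast+
  ultimately show ?thesis
    by (simp add: sums_unique2)
qed

lemma AE_steps: "AE s in steps \<mu>. \<forall>k. s k \<in> set_pmf \<mu>"
  unfolding AE_all_countable steps_def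
  by (intro allI AE_PiM_component prob_space_measure_pmf)
     (auto simp: AE_measure_pmf_iff)

text \<open>Almost every sequence of steps stays in the support, so events need only be compared there. For
  the walks below this means that all words may be taken to be reduced.\<close>

lemma pr_mono:
  assumes "\<And>s. (\<forall>k. s k \<in> set_pmf \<mu>) \<Longrightarrow> P s \<Longrightarrow> Q s" "Measurable.pred (steps \<mu>) Q"
  shows "pr \<mu> P \<le> pr \<mu> Q"
proof -
  interpret prob_space "steps \<mu>" by (rule prob_space_steps)
  show ?thesis
  proof (rule finite_measure_mono_AE)
    show "AE s in steps \<mu>. s \<in> {s. P s} \<longrightarrow> s \<in> {s. Q s}"
      using AE_steps[of \<mu>] by eventually_elim (use assms in auto)
  qed (use assms in \<open>auto intro: pred_sets_steps\<close>)
qed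

lemma pr_cong:
  assumes "\<And>s. (\<forall>k. s k \<in> set_pmf \<mu>) \<Longrightarrow> P s \<longleftrightarrow> Q s"
    "Measurable.pred (steps \<mu>) P" "Measurable.pred (steps \<mu>) Q"
  shows "pr \<mu> P = pr \<mu> Q"
  using assms by (intro antisym pr_mono) auto

lemma pr_le_1: "pr \<mu> P \<le> 1"
  using prob_space.prob_le_1[OF prob_space_steps] .

lemma AE_not_iff_pr_eq_0: 
  assumes "Measurable.pred (steps \<mu>) P"
  shows "(AE s in steps \<mu>. \<not> P s) \<longleftrightarrow> pr \<mu> P = 0"
proof -
  interpret prob_space "steps \<mu>" by (rule prob_space_steps)
  show ?thesis
    using prob_eq_0[OF pred_sets_steps[OF assms]] by auto
qed

lemma distr_steps_map:
  assumes "map_pmf f \<mu> = \<mu>"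
  shows "distr (steps \<mu>) (steps \<mu>) (\<lambda>s k. f (s k)) = steps \<mu>"
proof -
  interpret sequence_space "measure_pmf \<mu>"
    by standard
  have S: "steps \<mu> = S" by (simp add: steps_def)
  have f: "(\<lambda>s k. f (s k)) \<in> measurable (steps \<mu>) (steps \<mu>)"
    by (intro measurable_steps measurable_compose[OF step_measurable]) simp
  show ?thesis unfolding S
  proof (rule PiM_eq)
    fix J :: "nat set" and E :: "nat \<Rightarrow> letter list set"
    assume J: "finite J" "J \<subseteq> UNIV" "\<And>j. j \<in> J \<Longrightarrow> E j \<in> sets (measure_pmf \<mu>)"
    have "emeasure (distr S S (\<lambda>s k. f (s k))) (prod_emb UNIV (\<lambda>i. measure_pmf \<mu>) J (Pi\<^sub>E J E))
      = emeasure S ((\<lambda>s k. f (s k)) -` prod_emb UNIV (\<lambda>i. measure_pmf \<mu>) J (Pi\<^sub>E J E) \<inter> space S)"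
      using f J by (intro emeasure_distr) (auto simp: S intro!: sets_PiM_I)
    also have "(\<lambda>s k. f (s k)) -` prod_emb UNIV (\<lambda>i. measure_pmf \<mu>) J (Pi\<^sub>E J E) \<inter> space S
       = prod_emb UNIV (\<lambda>i. measure_pmf \<mu>) J (Pi\<^sub>E J (\<lambda>j. f -` E j))"
      by (auto simp: prod_emb_def space_PiM PiE_iff)
    also have "emeasure S \<dots> = (\<Prod>j\<in>J. emeasure (measure_pmf \<mu>) (f -` E j))"
      using J by (intro emeasure_PiM_emb) auto
    also have "\<dots> = (\<Prod>j\<in>J. emeasure (measure_pmf \<mu>) (E j))"
      by (metis assms emeasure_map_pmf)
    finally show "emeasure (distr S S (\<lambda>s k. f (s k))) (prod_emb UNIV (\<lambda>i. measure_pmf \<mu>) J (Pi\<^sub>E J E))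
      = (\<Prod>j\<in>J. emeasure (measure_pmf \<mu>) (E j))" .
  qed simp
qed

lemma pr_map:
  assumes "map_pmf f \<mu> = \<mu>" "Measurable.pred (steps \<mu>) Q"
  shows "pr \<mu> (\<lambda>s. Q (\<lambda>k. f (s k))) = pr \<mu> Q"
proof -
  have f: "(\<lambda>s k. f (s k)) \<in> measurable (steps \<mu>) (steps \<mu>)"
    by (intro measurable_steps measurable_compose[OF step_measurable]) simp
  have "pr \<mu> Q = measure (distr (steps \<mu>) (steps \<mu>) (\<lambda>s k. f (s k))) {s. Q s}"
    by (simp add: distr_steps_map[OF assms(1)])
  also have "\<dots> = pr \<mu> (\<lambda>s. Q (\<lambda>k. f (s k)))"
    by (subst measure_distr[OF f pred_sets_steps[OF assms(2)]]) (simp add: vimage_def)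
  finally show ?thesis by simp
qed

lemma sum_pr:
  assumes "finite X" "\<And>x. x \<in> X \<Longrightarrow> Measurable.pred (steps \<mu>) (Q x)"
    and "\<And>s x y. x \<in> X \<Longrightarrow> y \<in> X \<Longrightarrow> Q x s \<Longrightarrow> Q y s \<Longrightarrow> x = y"
  shows "(\<Sum>x\<in>X. pr \<mu> (Q x)) = pr \<mu> (\<lambda>s. \<exists>x\<in>X. Q x s)"
proof -
  interpret prob_space "steps \<mu>" by (rule prob_space_steps)
  have "measure (steps \<mu>) (\<Union>x\<in>X. {s. Q x s}) = (\<Sum>x\<in>X. pr \<mu> (Q x))"
    using assms by (intro finite_measure_finite_Union)
      (auto simp: disjoint_family_on_def intro: pred_sets_steps)
  also have "(\<Union>x\<in>X. {s. Q x s}) = {s. \<exists>x\<in>X. Q x s}" by auto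
  finally show ?thesis by simp
qed

lemma pr_True: "pr \<mu> (\<lambda>s. True) = 1"
  using prob_space.prob_space[OF prob_space_steps, of \<mu>] by simp

lemma pr_not: "Measurable.pred (steps \<mu>) Q \<Longrightarrow> pr \<mu> (\<lambda>s. \<not> Q s) = 1 - pr \<mu> Q"
  using prob_space.prob_compl[OF prob_space_steps pred_sets_steps, of Q \<mu>]
  by (simp add: Compl_eq_Diff_UNIV[symmetric] Collect_neg_eq)

lemma pr_disjoint:
  assumes "Measurable.pred (steps \<mu>) P" "Measurable.pred (steps \<mu>) Q" "\<And>s. \<not> (P s \<and> Q s)"
  shows "pr \<mu> (\<lambda>s. P s \<or> Q s) = pr \<mu> P + pr \<mu> Q"
proof -
  interpret prob_space "steps \<mu>" by (rule prob_space_steps)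
  have "measure (steps \<mu>) ({s. P s} \<union> {s. Q s}) = pr \<mu> P + pr \<mu> Q"
    using assms by (intro finite_measure_Union pred_sets_steps) auto
  then show ?thesis by (simp add: Collect_disj_eq)
qed

section \<open>Walks by powers of the generators and their first passages\<close>

text \<open>The step law is symmetric exactly if it is invariant under \<open>flip\<close>, because its support consists of
  powers of the generators. Invariance is the convenient form, since \<open>flip\<close> acts on whole paths as an
  automorphism.\<close>

locale power_walk =
  fixes m n :: nat and \<mu> :: "letter list pmf"
  assumes support: "set_pmf \<mu> = {replicate r x | r x. 1 \<le> r \<and> r \<le> n \<and> fst x \<in> {1..m}}"
    and n_pos: "1 \<le> n"
    and flip_invariant: "map_pmf flip \<mu> = \<mu>"
    and transient: "transient m \<mu>"
begin

abbreviation W :: "(nat \<Rightarrow> letter list) \<Rightarrow> nat \<Rightarrow> letter list" where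
  "W \<equiv> walk m []"

abbreviation F :: "letter list \<Rightarrow> real" where
  "F y \<equiv> pr \<mu> (\<lambda>s. \<exists>t. W s t = y)"

lemma step_carrier: "g \<in> set_pmf \<mu> \<Longrightarrow> g \<in> carrier (free_group m)"
  by (auto simp: support intro!: replicate_carrier)

lemma step_reduced: "g \<in> set_pmf \<mu> \<Longrightarrow> reduced g"
  using step_carrier by (auto simp: carrier_free_group)

lemma walk_carrier:
  assumes "\<forall>k. s k \<in> set_pmf \<mu>"
  shows "W s t \<in> carrier (free_group m)"
proof (induction t)
  case (Suc t)
  then show ?case
    using assms step_carrier group.is_monoid[OF group_free_group, of m]
    by (simp del: mult_free_group add: monoid.m_closed)
qed (simp add: carrier_free_group)

lemma walk_reduced: "(\<forall>k. s k \<in> set_pmf \<mu>) \<Longrightarrow> reduced (W s t)"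
  using walk_carrier by (auto simp: carrier_free_group)

lemma walk_shift:
  assumes "\<forall>k. s k \<in> set_pmf \<mu>"
  shows "W s (t + u) = W s t \<odot> W (shift t s) u"
proof (induction u)
  case 0
  then show ?case using walk_reduced[OF assms] by (simp add: foldr_cons_red_Nil)
next
  case (Suc u)
  then show ?case using assms step_reduced by (simp add: foldr_cons_red_assoc)
qed

lemma walk_flip: "W (\<lambda>k. flip (s k)) t = flip (W s t)"
  by (induction t) (auto simp: flip_mult)

lemma pr_flip: "Measurable.pred (steps \<mu>) Q \<Longrightarrow> pr \<mu> (\<lambda>s. Q (\<lambda>k. flip (s k))) = pr \<mu> Q"
  by (rule pr_map[OF flip_invariant])

lemma F_flip: "F (flip y) = F y"
proof -
  have "F (flip y) = pr \<mu> (\<lambda>s. \<exists>t. W (\<lambda>k. flip (s k)) t = flip y)"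
    by (rule pr_flip[symmetric, of "\<lambda>s. \<exists>t. W s t = flip y"]) (intro path_event)+
  also have "\<dots> = F y"
    unfolding walk_flip flip_eq_iff flip_flip ..
  finally show ?thesis .
qed

lemma ex_first_visit_iff: "(\<exists>t. W s t = y \<and> (\<forall>j<t. W s j \<noteq> y)) \<longleftrightarrow> (\<exists>t. W s t = y)"
  using exists_least_iff[of "\<lambda>t. W s t = y"] by (rule sym)

lemma F_sums: "(\<lambda>t. pr \<mu> (\<lambda>s. W s t = y \<and> (\<forall>j<t. W s j \<noteq> y))) sums F y"
proof -
  have "(\<lambda>t. pr \<mu> (\<lambda>s. W s t = y \<and> (\<forall>j<t. W s j \<noteq> y))) sums
      pr \<mu> (\<lambda>s. \<exists>t. W s t = y \<and> (\<forall>j<t. W s j \<noteq> y))"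
  proof (rule sums_pr)
    show "t = u" if "W s t = y \<and> (\<forall>j<t. W s j \<noteq> y)" "W s u = y \<and> (\<forall>j<u. W s j \<noteq> y)" for s t u
      using that by (metis nat_neq_iff)
  qed (intro path_event)+
  also have "(\<lambda>s. \<exists>t. W s t = y \<and> (\<forall>j<t. W s j \<noteq> y)) = (\<lambda>s. \<exists>t. W s t = y)"
    by (intro ext) (rule ex_first_visit_iff)
  finally show ?thesis .
qed

lemma first_passage_eq: "first_passage m \<mu> [] y = F y"
  unfolding first_passage_def using sums_unique[OF F_sums] by simp

lemma first_visit_markov:
  assumes "Measurable.pred (steps \<mu>) D"
  shows "pr \<mu> (\<lambda>s. \<exists>t. (W s t = y \<and> (\<forall>j<t. W s j \<noteq> y)) \<and> D (shift t s)) = F y * pr \<mu> D"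
proof -
  have "pr \<mu> (\<lambda>s. \<exists>t. (W s t = y \<and> (\<forall>j<t. W s j \<noteq> y)) \<and> D (shift t s)) =
      pr \<mu> (\<lambda>s. \<exists>t. W s t = y \<and> (\<forall>j<t. W s j \<noteq> y)) * pr \<mu> D"
  proof (rule strong_markov_property[where Q = "\<lambda>t s. W s t = y \<and> (\<forall>j<t. W s j \<noteq> y)" and D = D])
    show "t = u" if "W s t = y \<and> (\<forall>j<t. W s j \<noteq> y)" "W s u = y \<and> (\<forall>j<u. W s j \<noteq> y)" for s t u
      using that by (metis nat_neq_iff)
    show "(W s t = y \<and> (\<forall>j<t. W s j \<noteq> y)) = (W s' t = y \<and> (\<forall>j<t. W s' j \<noteq> y))"
      if "\<And>k. k < t \<Longrightarrow> s k = s' k" for t s s'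
      using walk_cong[OF that] by auto
  qed (intro path_event assms)+
  also have "(\<lambda>s. \<exists>t. W s t = y \<and> (\<forall>j<t. W s j \<noteq> y)) = (\<lambda>s. \<exists>t. W s t = y)"
    by (intro ext) (rule ex_first_visit_iff)
  finally show ?thesis .
qed

text \<open>One way of visiting \<open>x \<odot> y\<close> is to visit \<open>x\<close> and to move on by \<open>y\<close> from the time of the first visit.\<close>

lemma F_supermultiplicative: "F x * F y \<le> F (x \<odot> y)"
proof -
  have "F x * F y = pr \<mu> (\<lambda>s. \<exists>t. (W s t = x \<and> (\<forall>j<t. W s j \<noteq> x)) \<and> (\<exists>u. W (shift t s) u = y))"
    by (rule first_visit_markov[symmetric, where D = "\<lambda>s. \<exists>u. W s u = y"]) (intro path_event)+
  also have "\<dots> \<le> F (x \<odot> y)"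
  proof (rule pr_mono)
    fix s assume s: "\<forall>k. s k \<in> set_pmf \<mu>"
      and "\<exists>t. (W s t = x \<and> (\<forall>j<t. W s j \<noteq> x)) \<and> (\<exists>u. W (shift t s) u = y)"
    then obtain t u where "W s t = x" "W (shift t s) u = y" by blast
    then have "W s (t + u) = x \<odot> y" using walk_shift[OF s, of t u] by simp
    then show "\<exists>t. W s t = x \<odot> y" ..
  next
    show "Measurable.pred (steps \<mu>) (\<lambda>s. \<exists>t. W s t = x \<odot> y)"
      by (intro path_event)
  qed
  finally show ?thesis .
qed

lemma step_prob: "pr \<mu> (\<lambda>s. s 0 = g) = pmf \<mu> g"
proof -
  have "distr (steps \<mu>) (measure_pmf \<mu>) (\<lambda>s. s 0) = measure_pmf \<mu>"
    unfolding steps_def by (intro distr_PiM_component prob_space_measure_pmf) auto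
  then have "pmf \<mu> g = measure (distr (steps \<mu>) (measure_pmf \<mu>) (\<lambda>s. s 0)) {g}"
    by (simp add: measure_pmf_single)
  also have "\<dots> = measure (steps \<mu>) ((\<lambda>s. s 0) -` {g} \<inter> space (steps \<mu>))"
    by (rule measure_distr)
       (use step_measurable[of 0 \<mu>] in \<open>simp_all add: measurable_cong_sets[OF refl sets_measure_pmf_count_space]\<close>)
  finally show ?thesis by (simp add: vimage_def)
qed

end

lemma power_walkI:
  fixes m n :: nat and \<mu> :: "letter list pmf"
  assumes n: "n \<ge> 1"
    and symmetric: "\<And>g. g \<in> carrier (free_group m) \<Longrightarrow> pmf \<mu> (inv\<^bsub>free_group m\<^esub> g) = pmf \<mu> g"
    and support: "set_pmf \<mu> =
      {gen i [^]\<^bsub>free_group m\<^esub> j | (i::nat) (j::int). 1 \<le> i \<and> i \<le> m \<and> 1 \<le> \<bar>j\<bar> \<and> \<bar>j\<bar> \<le> int n}"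
    and transient: "transient m \<mu>"
  shows "power_walk m n \<mu>"
proof
  show S: "set_pmf \<mu> = {replicate r x | r x. 1 \<le> r \<and> r \<le> n \<and> fst x \<in> {1..m}}"
    unfolding support
  proof (intro equalityI subsetI)
    fix g assume "g \<in> {gen i [^]\<^bsub>free_group m\<^esub> j | (i::nat) (j::int).
      1 \<le> i \<and> i \<le> m \<and> 1 \<le> \<bar>j\<bar> \<and> \<bar>j\<bar> \<le> int n}"
    then obtain i j where "1 \<le> i" "i \<le> m" "1 \<le> \<bar>j\<bar>" "\<bar>j\<bar> \<le> int n"
      and g: "g = gen i [^]\<^bsub>free_group m\<^esub> (j::int)" by blast
    moreover from this have "g = replicate (nat \<bar>j\<bar>) (i, 0 \<le> j)" by (simp add: gen_int_pow)
    ultimately show "g \<in> {replicate r x | r x. 1 \<le> r \<and> r \<le> n \<and> fst x \<in> {1..m}}"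
      by (intro CollectI exI[of _ "nat \<bar>j\<bar>"] exI[of _ "(i, 0 \<le> j)"]) auto
  next
    fix g :: "letter list" assume "g \<in> {replicate r x | r x. 1 \<le> r \<and> r \<le> n \<and> fst x \<in> {1..m}}"
    then obtain r i b where g: "g = replicate r (i, b)" "1 \<le> r" "r \<le> n" "i \<in> {1..m}" by auto
    define j where "j = (if b then int r else - int r)"
    have "g = gen i [^]\<^bsub>free_group m\<^esub> j"
      using g by (subst gen_int_pow) (auto simp: j_def)
    moreover have "\<bar>j\<bar> = int r" by (simp add: j_def)
    ultimately show "g \<in> {gen i [^]\<^bsub>free_group m\<^esub> j | (i::nat) (j::int).
      1 \<le> i \<and> i \<le> m \<and> 1 \<le> \<bar>j\<bar> \<and> \<bar>j\<bar> \<le> int n}"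
      using g by (intro CollectI exI[of _ i] exI[of _ j]) auto
  qed
  have flip_support: "flip g \<in> set_pmf \<mu>" if "g \<in> set_pmf \<mu>" for g
    using that unfolding S by fastforce
  have flip_pmf: "pmf \<mu> (flip g) = pmf \<mu> g" for g
  proof (cases "g \<in> set_pmf \<mu>")
    case True
    then obtain r x where g: "g = replicate r x" "fst x \<in> {1..m}" unfolding S by blast
    then have "g \<in> carrier (free_group m)" by (simp add: replicate_carrier)
    then have "pmf \<mu> (rev (flip g)) = pmf \<mu> g" using symmetric inv_free_group by metis
    then show ?thesis by (simp add: g)
  next
    case False
    then have "flip g \<notin> set_pmf \<mu>" using flip_support[of "flip g"] flip_flip by metis
    with False show ?thesis by (simp add: set_pmf_iff)
  qed
  show "map_pmf flip \<mu> = \<mu>"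
  proof (rule pmf_eqI)
    fix g
    have "inj flip" by (metis flip_flip injI)
    then have "pmf (map_pmf flip \<mu>) (flip (flip g)) = pmf \<mu> (flip g)"
      by (rule pmf_map_inj')
    then show "pmf (map_pmf flip \<mu>) g = pmf \<mu> g" unfolding flip_flip flip_pmf .
  qed
qed (use n transient in auto)

section \<open>Consequences of transience\<close>

context power_walk
begin

lemma finite_visits_Nil: "pr \<mu> (\<lambda>s. \<forall>N. \<exists>t\<ge>N. W s t = []) = 0"
proof -
  interpret prob_space "steps \<mu>" by (rule prob_space_steps)
  have "AE s in steps \<mu>. eventually (\<lambda>t. s \<in> space (steps \<mu>) - {s. W s t = []}) sequentially"
    using transient
    by (intro borel_cantelli_AE1) (auto simp: transient_def less_top[symmetric] intro!: pred_sets_steps pred_walk)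
  then have "AE s in steps \<mu>. \<not> (\<forall>N. \<exists>t\<ge>N. W s t = [])"
    by eventually_elim (auto simp: eventually_sequentially)
  then show ?thesis
    by (subst (asm) AE_not_iff_pr_eq_0) (intro path_event)+
qed

text \<open>From the first visit to \<open>g\<close> on, visits to \<open>g\<close> are visits of the shifted walk to the identity.\<close>

lemma finite_visits:
  assumes "g \<in> carrier (free_group m)"
  shows "pr \<mu> (\<lambda>s. \<forall>N. \<exists>t\<ge>N. W s t = g) = 0"
proof -
  have g: "reduced g" using assms by (simp add: carrier_free_group)
  have "pr \<mu> (\<lambda>s. \<forall>N. \<exists>t\<ge>N. W s t = g) \<le>
      pr \<mu> (\<lambda>s. \<exists>t. (W s t = g \<and> (\<forall>j<t. W s j \<noteq> g)) \<and> (\<forall>N. \<exists>u\<ge>N. W (shift t s) u = []))"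
  proof (rule pr_mono)
    fix s assume s: "\<forall>k. s k \<in> set_pmf \<mu>" and io: "\<forall>N. \<exists>t\<ge>N. W s t = g"
    then have "\<exists>t. W s t = g" by blast
    then obtain t where t: "W s t = g" "\<forall>j<t. W s j \<noteq> g"
      unfolding ex_first_visit_iff[symmetric] by blast
    have "\<exists>u\<ge>N. W (shift t s) u = []" for N
    proof -
      obtain v where v: "v \<ge> t + N" "W s v = g" using io by blast
      then have "g \<odot> W (shift t s) (v - t) = g \<odot> []"
        using walk_shift[OF s, of t "v - t"] t g by (simp add: foldr_cons_red_Nil)
      then have "W (shift t s) (v - t) = []"
        using mult_left_cancel_iff[of g "W (shift t s) (v - t)" "[]"] g walk_reduced[of "shift t s"] s
        by simp
      then show ?thesis using v by (intro exI[of _ "v - t"]) auto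
    qed
    then show "\<exists>t. (W s t = g \<and> (\<forall>j<t. W s j \<noteq> g)) \<and> (\<forall>N. \<exists>u\<ge>N. W (shift t s) u = [])"
      using t by blast
  next
show "Measurable.pred (steps \<mu>)
        (\<lambda>s. \<exists>t. (W s t = g \<and> (\<forall>j<t. W s j \<noteq> g)) \<and> (\<forall>N. \<exists>u\<ge>N. W (shift t s) u = []))"
      by (intro path_event)+
  qed
  also have "\<dots> = F g * pr \<mu> (\<lambda>s. \<forall>N. \<exists>u\<ge>N. W s u = [])"
    by (rule first_visit_markov[where D = "\<lambda>s. \<forall>N. \<exists>u\<ge>N. W s u = []"]) (intro path_event)+
  also have "\<dots> = 0" by (simp add: finite_visits_Nil)
  finally show ?thesis using measure_nonneg[of "steps \<mu>"] by (simp add: order_antisym)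
qed

text \<open>Otherwise almost surely every visit to the identity is followed by another one. Since the walk starts
  there, it would visit the identity infinitely often.\<close>

lemma no_return_pos: "pr \<mu> (\<lambda>s. \<forall>t\<ge>1. W s t \<noteq> []) > 0"
proof (rule ccontr)
  assume "\<not> ?thesis"
  then have zero: "pr \<mu> (\<lambda>s. \<forall>t\<ge>1. W s t \<noteq> []) = 0"
    using measure_nonneg[of "steps \<mu>" "{s. \<forall>t\<ge>1. W s t \<noteq> []}"] by linarith
  have "pr \<mu> (\<lambda>s. W s t = [] \<and> (\<forall>u\<ge>1. W s (t + u) \<noteq> [])) = 0" for t
  proof -
    have "pr \<mu> (\<lambda>s. W s t = [] \<and> (\<forall>u\<ge>1. W s (t + u) \<noteq> []))
        \<le> pr \<mu> (\<lambda>s. W s t = [] \<and> (\<forall>u\<ge>1. W (shift t s) u \<noteq> []))"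
    proof (rule pr_mono)
      show "W s t = [] \<and> (\<forall>u\<ge>1. W (shift t s) u \<noteq> [])"
        if "\<forall>k. s k \<in> set_pmf \<mu>" "W s t = [] \<and> (\<forall>u\<ge>1. W s (t + u) \<noteq> [])" for s
        using that(2) by (auto simp: walk_shift[OF that(1)])
      show "Measurable.pred (steps \<mu>) (\<lambda>s. W s t = [] \<and> (\<forall>u\<ge>1. W (shift t s) u \<noteq> []))"
        by (intro path_event)+
    qed
    also have "\<dots> = pr \<mu> (\<lambda>s. W s t = []) * pr \<mu> (\<lambda>s. \<forall>u\<ge>1. W s u \<noteq> [])"
    proof (rule markov_property[where D = "\<lambda>s. \<forall>u\<ge>1. W s u \<noteq> []"])
      show "(W s t = []) = (W s' t = [])" if "\<And>k. k < t \<Longrightarrow> s k = s' k" for s s'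
        using walk_cong[OF that] by auto
    qed (intro path_event)+
    finally show ?thesis using zero measure_nonneg[of "steps \<mu>"] by (simp add: order_antisym)
  qed
  moreover have "Measurable.pred (steps \<mu>) (\<lambda>s. W s t = [] \<and> (\<forall>u\<ge>1. W s (t + u) \<noteq> []))" for t
    by (intro path_event)+
  ultimately have "AE s in steps \<mu>. \<forall>t. \<not> (W s t = [] \<and> (\<forall>u\<ge>1. W s (t + u) \<noteq> []))"
    unfolding AE_all_countable by (subst AE_not_iff_pr_eq_0) auto
  moreover have "AE s in steps \<mu>. \<not> (\<forall>N. \<exists>t\<ge>N. W s t = [])"
    by (subst AE_not_iff_pr_eq_0) (intro path_event, rule finite_visits_Nil)
  ultimately have "AE s in steps \<mu>. False"
  proof eventually_elim
    case (elim s)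
    have "\<exists>t\<ge>N. W s t = []" for N
    proof (induction N)
      case (Suc N)
      then obtain t where t: "t \<ge> N" "W s t = []" by blast
      then obtain u where "u \<ge> 1" "W s (t + u) = []" using elim(1) by blast
      then show ?case using t by (intro exI[of _ "t + u"]) auto
    qed (auto intro: exI[of _ 0])
    then show ?case using elim(2) by blast
  qed
  then show False
    using prob_space.AE_False[OF prob_space_steps] by blast
qed

lemma length_walk: "\<forall>k. s k \<in> set_pmf \<mu> \<Longrightarrow> length (W s t) \<le> n * t"
proof (induction t)
  case (Suc t)
  have "length (W s t \<odot> s t) \<le> length (W s t) + length (s t)"
    by (rule length_mult)
  moreover have "s t \<in> set_pmf \<mu>" using Suc.prems by blast
  then have "length (s t) \<le> n" by (auto simp: support)
  ultimately show ?case using Suc by simp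
qed simp

text \<open>By the Markov property and the invariance under \<open>flip\<close>, the return probability at time \<open>2 k\<close> is the sum
  of the squares of the weights of the law of \<open>W k\<close>. That law lives on the \<open>2 n k + 1\<close> powers of \<open>a\<^sub>1\<close> of
  length at most \<open>n k\<close>, so the Cauchy-Schwarz inequality bounds the sum from below; counting the
  identity once for each sign gives the constant.\<close>

lemma return_prob_rank_one:
  assumes "m = 1"
  shows "1 \<le> pr \<mu> (\<lambda>s. W s (k + k) = []) * (2 * (n * k + 1))"
proof -
  define X where "X = (\<lambda>(r, b). replicate r (1::nat, b)) ` ({..n * k} \<times> (UNIV :: bool set))"
  have fin: "finite X" by (simp add: X_def)
  have card: "real (card X) \<le> 2 * (n * k + 1)"
  proof -
    have "card X \<le> card ({..n * k} \<times> (UNIV :: bool set))"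
      unfolding X_def by (rule card_image_le) simp
    also have "\<dots> = 2 * (n * k + 1)" by (simp add: card_cartesian_product)
    finally have "real (card X) \<le> real (2 * (n * k + 1))" by (rule of_nat_mono)
    then show ?thesis by simp
  qed
  have range: "W s k \<in> X" if s: "\<forall>k. s k \<in> set_pmf \<mu>" for s
  proof -
    have "reduced (W s k)" "W s k \<in> axis 1"
      using walk_carrier[OF s, of k] assms by (auto simp: carrier_free_group axis_def)
    then obtain r b where "W s k = replicate r (1, b)" by (rule reduced_axisD)
    moreover from this have "r \<le> n * k" using length_walk[OF s, of k] by simp
    ultimately show ?thesis by (auto simp: X_def)
  qed
  have "(\<Sum>x\<in>X. pr \<mu> (\<lambda>s. W s k = x)) = pr \<mu> (\<lambda>s. \<exists>x\<in>X. W s k = x)"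
    by (rule sum_pr[OF fin]) (auto intro: path_event)
  also have "\<dots> = pr \<mu> (\<lambda>s. True)"
    using range by (intro pr_cong) (auto intro: path_event)
  finally have total: "(\<Sum>x\<in>X. pr \<mu> (\<lambda>s. W s k = x)) = 1" by (simp only: pr_True)
  have "(\<Sum>x\<in>X. (pr \<mu> (\<lambda>s. W s k = x))\<^sup>2) =
      (\<Sum>x\<in>X. pr \<mu> (\<lambda>s. W s k = x \<and> W (shift k s) k = flip x))"
  proof (rule sum.cong[OF refl])
    fix x
    have "pr \<mu> (\<lambda>s. W s k = x \<and> W (shift k s) k = flip x) =
        pr \<mu> (\<lambda>s. W s k = x) * pr \<mu> (\<lambda>s. W s k = flip x)"
    proof (rule markov_property[where D = "\<lambda>s. W s k = flip x"])
      show "(W s k = x) = (W s' k = x)" if "\<And>j. j < k \<Longrightarrow> s j = s' j" for s s'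
        using walk_cong[OF that] by auto
    qed (intro path_event)+
    also have "pr \<mu> (\<lambda>s. W s k = flip x) = pr \<mu> (\<lambda>s. W (\<lambda>j. flip (s j)) k = flip x)"
      by (rule pr_flip[symmetric, of "\<lambda>s. W s k = flip x"]) (intro path_event)
    also have "\<dots> = pr \<mu> (\<lambda>s. W s k = x)"
      unfolding walk_flip flip_eq_iff flip_flip ..
    finally show "(pr \<mu> (\<lambda>s. W s k = x))\<^sup>2 = pr \<mu> (\<lambda>s. W s k = x \<and> W (shift k s) k = flip x)"
      by (simp add: power2_eq_square)
  qed
  also have "\<dots> = pr \<mu> (\<lambda>s. \<exists>x\<in>X. W s k = x \<and> W (shift k s) k = flip x)"
    by (rule sum_pr[OF fin]) (intro path_event, blast)
  also have "\<dots> \<le> pr \<mu> (\<lambda>s. W s (k + k) = [])"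
  proof (rule pr_mono)
    fix s assume s: "\<forall>k. s k \<in> set_pmf \<mu>"
      and "\<exists>x\<in>X. W s k = x \<and> W (shift k s) k = flip x"
    then obtain r b where "W s k = replicate r (1, b)" "W (shift k s) k = flip (replicate r (1, b))"
      by (auto simp: X_def)
    then have "W s (k + k) = replicate r (1, b) \<odot> flip (replicate r (1, b))"
      using walk_shift[OF s, of k k] by simp
    also have "\<dots> = rev (flip (flip (replicate r (1, b)))) \<odot> flip (replicate r (1, b))"
      by (simp add: flip_flip del: map_map map_replicate)
    also have "\<dots> = []" by (rule foldr_cons_red_inverse)
    finally show "W s (k + k) = []" .
  qed (intro path_event)
  finally have sq: "(\<Sum>x\<in>X. (pr \<mu> (\<lambda>s. W s k = x))\<^sup>2) \<le> pr \<mu> (\<lambda>s. W s (k + k) = [])" .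
  have "1 = (\<Sum>x\<in>X. pr \<mu> (\<lambda>s. W s k = x))\<^sup>2" using total by simp
  also have "\<dots> \<le> (\<Sum>x\<in>X. (pr \<mu> (\<lambda>s. W s k = x))\<^sup>2) * card X"
    by (rule sum_squared_le_sum_of_squares)
  also have "\<dots> \<le> pr \<mu> (\<lambda>s. W s (k + k) = []) * (2 * (n * k + 1))"
    using sq card by (intro mult_mono) auto
  finally show ?thesis .
qed

text \<open>In rank one the return probabilities dominate a multiple of the harmonic series.\<close>

lemma rank_ge_two: "2 \<le> m"
proof (rule ccontr)
  assume "\<not> 2 \<le> m"
  moreover have "m \<noteq> 0"
    using set_pmf_not_empty[of \<mu>] support by auto
  ultimately have m: "m = 1" by simp
  have "summable (\<lambda>t. pr \<mu> (\<lambda>s. W s t = []))"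
    using transient by (simp add: transient_def)
  then have sum: "summable ((\<lambda>t. pr \<mu> (\<lambda>s. W s t = [])) \<circ> (\<lambda>k. k + k))"
    by (rule summable_reindex) (auto intro: injI)
  have "summable (\<lambda>k. 2 * real n * pr \<mu> (\<lambda>s. W s (k + k) = []))"
    using sum by (intro summable_mult) (simp add: o_def)
  then have "summable (\<lambda>k. inverse (real (Suc k)))"
  proof (rule summable_comparison_test'[where N = 0])
    fix k
    let ?p = "pr \<mu> (\<lambda>s. W s (k + k) = [])"
    have "1 \<le> ?p * (2 * (n * k + 1))" by (rule return_prob_rank_one[OF m])
    also have "\<dots> \<le> ?p * (2 * real n * real (Suc k))"
      using n_pos by (intro mult_left_mono) (auto simp: algebra_simps)
    finally show "norm (inverse (real (Suc k))) \<le> 2 * real n * ?p"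
      by (simp add: field_simps)
  qed
  then show False
    using not_summable_harmonic[where 'a = real] summable_Suc_iff[of "\<lambda>k. inverse (real k)"] by blast
qed

end

section \<open>Excursions from the powers of a generator\<close>

context power_walk
begin

text \<open>A step is a power of one generator, so it either moves along the axis or has no effect on the
  projection. This is why an excursion ends where it started.\<close>

lemma proj_walk_Suc:
  assumes s: "\<forall>k. s k \<in> set_pmf \<mu>" and out: "\<not> (W s t \<in> axis i \<and> W s (Suc t) \<in> axis i)"
  shows "proj i (W s (Suc t)) = proj i (W s t)"
proof -
  have "s t \<in> set_pmf \<mu>" using s by blast
  then obtain r x where x: "s t = replicate r x" by (auto simp: support)
  have "fst x \<noteq> i \<or> W s t \<notin> axis i"
  proof (rule ccontr)
    assume "\<not> ?thesis"
    then have "W s t \<odot> s t \<in> axis i"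
      using x by (intro axis_mult) (auto simp: axis_def)
    with out \<open>\<not> ?thesis\<close> show False by simp
  qed
  then show ?thesis
    using proj_mult_replicate[of "W s t" x i r] walk_reduced[OF s] x by simp
qed

text \<open>Let \<open>b\<close> be a generator other than \<open>a\<^sub>i\<close>. After a first step \<open>b\<close> the projection is the identity until the
  walk is back on the axis, so the return has to take place at the identity. If returns to the axis were
  certain, the walk would therefore certainly pass from \<open>b\<close> to \<open>e\<close>, and by \<open>F_flip\<close> also
  from \<open>e\<close> to \<open>b\<close>. It would then return to \<open>e\<close> almost surely, contrary to \<open>no_return_pos\<close>.\<close>

lemma no_return_axis_pos:
  assumes i: "i \<in> {1..m}"
  shows "pr \<mu> (\<lambda>s. \<forall>t\<ge>1. W s t \<notin> axis i) > 0"
proof (rule ccontr)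
  assume "\<not> ?thesis"
  then have zero: "pr \<mu> (\<lambda>s. \<forall>t\<ge>1. W s t \<notin> axis i) = 0"
    using measure_nonneg[of "steps \<mu>" "{s. \<forall>t\<ge>1. W s t \<notin> axis i}"] by linarith
  obtain l where l: "l \<in> {1..m}" "l \<noteq> i"
  proof (cases "i = 1")
    case True
    then show thesis using that[of 2] rank_ge_two by simp
  next
    case False
    then show thesis using that[of 1] rank_ge_two by simp
  qed
  define b where "b = [(l, True)]"
  have b: "reduced b" "b \<noteq> []" "b \<notin> axis i" "proj i b = []" "b \<odot> flip b = []"
    using l by (auto simp: b_def reduced_def axis_def proj_def cons_red_def)
  have "b = replicate 1 (l, True)" by (simp add: b_def)
  then have b_step: "b \<in> set_pmf \<mu>"
    unfolding support using l n_pos by fastforce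
  \<comment> \<open>Here \<open>flip b\<close> is the inverse of \<open>b\<close>: if the first step is \<open>b\<close> and the increments afterwards never
    multiply to \<open>flip b\<close>, the walk never comes back to the identity, hence not to the axis.\<close>
  have "pr \<mu> (\<lambda>s. s 0 = b) * pr \<mu> (\<lambda>s. \<not> (\<exists>u. W s u = flip b)) =
      pr \<mu> (\<lambda>s. s 0 = b \<and> \<not> (\<exists>u. W (shift 1 s) u = flip b))"
    by (rule markov_property[symmetric, where D = "\<lambda>s. \<not> (\<exists>u. W s u = flip b)"])
       (auto intro!: path_event measurable_compose[OF step_measurable])
  also have "\<dots> \<le> pr \<mu> (\<lambda>s. \<forall>t\<ge>1. W s t \<notin> axis i)"
  proof (rule pr_mono)
    fix s assume s: "\<forall>k. s k \<in> set_pmf \<mu>"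
      and s0: "s 0 = b \<and> \<not> (\<exists>u. W (shift 1 s) u = flip b)"
    have W1: "W s 1 = b" using s0 b by (simp add: foldr_cons_red_Nil b_def cons_red_def)
    have "W s (Suc u) \<notin> axis i \<and> proj i (W s (Suc u)) = []" for u
    proof (induction u)
      case 0
      then show ?case using W1 b by simp
    next
      case (Suc u)
      have proj: "proj i (W s (Suc (Suc u))) = []"
        using Suc proj_walk_Suc[OF s, of "Suc u" i] by simp
      moreover have "W s (Suc (Suc u)) \<notin> axis i"
      proof
        assume "W s (Suc (Suc u)) \<in> axis i"
        then have "W s (1 + Suc u) = []" using proj proj_axis by simp
        then have "b \<odot> W (shift 1 s) (Suc u) = b \<odot> flip b"
          using walk_shift[OF s, of 1 "Suc u"] W1 b by simp
        moreover have "reduced (W (shift 1 s) (Suc u))" using s by (intro walk_reduced) simp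
        moreover have "reduced (flip b)" by (simp add: b_def reduced_def)
        ultimately have "W (shift 1 s) (Suc u) = flip b"
          using mult_left_cancel_iff b(1) by blast
        with s0 show False by blast
      qed
      ultimately show ?case by simp
    qed
    then show "\<forall>t\<ge>1. W s t \<notin> axis i"
      by (metis One_nat_def Suc_le_D)
  qed (intro path_event)
  finally have "pmf \<mu> b * (1 - F (flip b)) \<le> 0"
    unfolding zero step_prob by (subst (asm) pr_not) (intro path_event)
  moreover have "pmf \<mu> b > 0" using b_step by (simp add: pmf_positive)
  ultimately have "F (flip b) \<ge> 1" by (simp add: mult_le_0_iff)
  then have F1: "F (flip b) = 1" "F b = 1"
    using pr_le_1[of \<mu> "\<lambda>s. \<exists>t. W s t = flip b"] F_flip[of b] by auto
  have "1 = F b * F (flip b)" using F1 by simp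
  also have "\<dots> = pr \<mu> (\<lambda>s. \<exists>t. (W s t = b \<and> (\<forall>j<t. W s j \<noteq> b)) \<and> (\<exists>u. W (shift t s) u = flip b))"
    by (rule first_visit_markov[symmetric, where D = "\<lambda>s. \<exists>u. W s u = flip b"]) (intro path_event)
  also have "\<dots> \<le> pr \<mu> (\<lambda>s. \<not> (\<forall>t\<ge>1. W s t \<noteq> []))"
  proof (rule pr_mono)
    fix s assume s: "\<forall>k. s k \<in> set_pmf \<mu>"
      and "\<exists>t. (W s t = b \<and> (\<forall>j<t. W s j \<noteq> b)) \<and> (\<exists>u. W (shift t s) u = flip b)"
    then obtain t u where tu: "W s t = b" "W (shift t s) u = flip b" by blast
    then have "W s (t + u) = []" using walk_shift[OF s, of t u] b by simp
    moreover have "t \<noteq> 0" using tu b by (cases t) auto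
    ultimately show "\<not> (\<forall>t\<ge>1. W s t \<noteq> [])"
      by (intro notI, elim allE[of _ "t + u"]) simp
  qed (intro path_event)
  also have "\<dots> = 1 - pr \<mu> (\<lambda>s. \<forall>t\<ge>1. W s t \<noteq> [])"
    by (rule pr_not) (intro path_event)
  finally show False using no_return_pos by simp
qed

text \<open>The axis is a subgroup, so seen from the first return to it the walk starts afresh. The probability
  \<open>h\<close> of infinitely many visits thus satisfies \<open>h = (1 - \<kappa>) h\<close>, where \<open>\<kappa> > 0\<close> is the probability of
  no return.\<close>

lemma finite_visits_axis:
  assumes i: "i \<in> {1..m}"
  shows "pr \<mu> (\<lambda>s. \<forall>N. \<exists>t\<ge>N. W s t \<in> axis i) = 0"
proof -
  let ?R = "\<lambda>t s. 1 \<le> t \<and> W s t \<in> axis i \<and> (\<forall>j<t. 1 \<le> j \<longrightarrow> W s j \<notin> axis i)"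
  let ?IO = "\<lambda>s. \<forall>N. \<exists>t\<ge>N. W s t \<in> axis i"
  let ?K = "\<lambda>s. \<forall>t\<ge>1. W s t \<notin> axis i"
  have return: "(\<exists>t. ?R t s) \<longleftrightarrow> \<not> ?K s" for s
    using exists_least_iff[of "\<lambda>t. 1 \<le> t \<and> W s t \<in> axis i"] by blast
  have "pr \<mu> ?IO \<le> pr \<mu> (\<lambda>s. \<exists>t. ?R t s \<and> ?IO (shift t s))"
  proof (rule pr_mono)
    fix s assume s: "\<forall>k. s k \<in> set_pmf \<mu>" and io: "?IO s"
    then have "\<not> ?K s" by blast
    then obtain t where t: "?R t s" using return[of s] by blast
    have "\<exists>u\<ge>N. W (shift t s) u \<in> axis i" for N
    proof -
      obtain v where v: "v \<ge> t + N" "W s v \<in> axis i" using io by blast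
      then have "W s t \<odot> W (shift t s) (v - t) \<in> axis i"
        using walk_shift[OF s, of t "v - t"] by simp
      then have "W (shift t s) (v - t) \<in> axis i"
        using axis_mult_iff[of "W s t" "W (shift t s) (v - t)" i] t s walk_reduced by simp
      then show ?thesis using v by (intro exI[of _ "v - t"]) auto
    qed
    with t show "\<exists>t. ?R t s \<and> ?IO (shift t s)" by blast
  qed (intro path_event)
  also have "\<dots> = pr \<mu> (\<lambda>s. \<exists>t. ?R t s) * pr \<mu> ?IO"
  proof (rule strong_markov_property[where Q = ?R and D = ?IO])
    show "?R t s = ?R t s'" if "\<And>k. k < t \<Longrightarrow> s k = s' k" for t s s'
      using walk_cong[OF that] by auto
    show "t = u" if "?R t s" "?R u s" for s t u
      using that by (metis nat_neq_iff)
  qed (intro path_event)+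
  also have "pr \<mu> (\<lambda>s. \<exists>t. ?R t s) = 1 - pr \<mu> ?K"
    unfolding return by (rule pr_not) (intro path_event)
  finally have "pr \<mu> ?K * pr \<mu> ?IO \<le> 0" by (simp add: algebra_simps)
  then show ?thesis
    using no_return_axis_pos[OF i] measure_nonneg[of "steps \<mu>" "{s. ?IO s}"]
    by (auto simp: mult_le_0_iff)
qed

definition last_visit :: "nat \<Rightarrow> letter list \<Rightarrow> (nat \<Rightarrow> letter list) \<Rightarrow> bool" where
  "last_visit i y s \<longleftrightarrow> (\<exists>t. W s t = y \<and> (\<forall>u>t. W s u \<notin> axis i))"

lemma pred_last_visit: "Measurable.pred (steps \<mu>) (last_visit i y)"
  unfolding last_visit_def[abs_def] by (intro path_event)

lemma last_visit_unique:
  assumes "last_visit i y s" "last_visit i z s" "y \<in> axis i" "z \<in> axis i"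
  shows "y = z"
  using assms by (metis last_visit_def nat_neq_iff)

text \<open>Translation by \<open>y\<close> preserves the axis, so seen from its first visit to \<open>y\<close> the walk has to make its
  last visit to the axis at the identity.\<close>

lemma pr_last_visit:
  assumes y: "reduced y" "y \<in> axis i"
  shows "pr \<mu> (last_visit i y) = F y * pr \<mu> (last_visit i [])"
proof -
  have shift_axis: "W s (t + u) \<in> axis i \<longleftrightarrow> W (shift t s) u \<in> axis i"
    if s: "\<forall>k. s k \<in> set_pmf \<mu>" and t: "W s t = y" for s t u
    using walk_shift[OF s, of t u] t axis_mult_iff[of y "W (shift t s) u" i] y walk_reduced[of "shift t s"] s
    by simp
  have shift_y: "W s (t + u) = y \<longleftrightarrow> W (shift t s) u = []"
    if s: "\<forall>k. s k \<in> set_pmf \<mu>" and t: "W s t = y" for s t u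
    using walk_shift[OF s, of t u] t mult_left_cancel_iff[of y "W (shift t s) u" "[]"] y
      walk_reduced[of "shift t s"] s
    by (simp add: foldr_cons_red_Nil)
  have "pr \<mu> (last_visit i y) =
      pr \<mu> (\<lambda>s. \<exists>t. (W s t = y \<and> (\<forall>j<t. W s j \<noteq> y)) \<and> last_visit i [] (shift t s))"
  proof (rule pr_cong)
    fix s :: "nat \<Rightarrow> letter list" assume s: "\<forall>k. s k \<in> set_pmf \<mu>"
    show "last_visit i y s \<longleftrightarrow>
      (\<exists>t. (W s t = y \<and> (\<forall>j<t. W s j \<noteq> y)) \<and> last_visit i [] (shift t s))"
    proof
      assume "last_visit i y s"
      then obtain v where v: "W s v = y" "\<forall>u>v. W s u \<notin> axis i" by (auto simp: last_visit_def)
      then obtain t where t: "W s t = y" "\<forall>j<t. W s j \<noteq> y"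
        using ex_first_visit_iff[of s y] by blast
      have "t \<le> v" using t v by (meson not_le)
      then have "W (shift t s) (v - t) = []"
        using shift_y[OF s t(1), of "v - t"] v by simp
      moreover have "W (shift t s) u \<notin> axis i" if "u > v - t" for u
        using shift_axis[OF s t(1), of u] v(2) that by auto
      ultimately show "\<exists>t. (W s t = y \<and> (\<forall>j<t. W s j \<noteq> y)) \<and> last_visit i [] (shift t s)"
        using t by (auto simp: last_visit_def)
    next
      assume "\<exists>t. (W s t = y \<and> (\<forall>j<t. W s j \<noteq> y)) \<and> last_visit i [] (shift t s)"
      then obtain t v where t: "W s t = y" and v: "W (shift t s) v = []"
          "\<forall>u>v. W (shift t s) u \<notin> axis i"
        by (auto simp: last_visit_def)
      have "W s (t + v) = y" using shift_y[OF s t] v by simp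
      moreover have "W s u \<notin> axis i" if "u > t + v" for u
        using shift_axis[OF s t, of "u - t"] v(2) that by simp
      ultimately show "last_visit i y s" by (auto simp: last_visit_def)
    qed
  next
    show "Measurable.pred (steps \<mu>)
      (\<lambda>s. \<exists>t. (W s t = y \<and> (\<forall>j<t. W s j \<noteq> y)) \<and> last_visit i [] (shift t s))"
      unfolding last_visit_def by (intro path_event)
  qed (rule pred_last_visit)
  also have "\<dots> = F y * pr \<mu> (last_visit i [])"
    by (rule first_visit_markov[where D = "last_visit i []"]) (rule pred_last_visit)
  finally show ?thesis .
qed

lemma last_visit_Nil_pos:
  assumes "i \<in> {1..m}"
  shows "pr \<mu> (last_visit i []) > 0"
proof -
  have "pr \<mu> (\<lambda>s. \<forall>t\<ge>1. W s t \<notin> axis i) \<le> pr \<mu> (last_visit i [])"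
  proof (rule pr_mono)
    show "last_visit i [] s" if "\<forall>t\<ge>1. W s t \<notin> axis i" for s
      using that by (auto simp: last_visit_def intro!: exI[of _ 0])
  qed (rule pred_last_visit)
  with no_return_axis_pos[OF assms] show ?thesis by linarith
qed

end

section \<open>Convergence to the boundary and the hitting measure\<close>

text \<open>Convergence to the boundary without mention of the limit. It involves only countable quantifiers over
  the positions of the path, which makes the corresponding event measurable.\<close>

definition settles :: "nat \<Rightarrow> (nat \<Rightarrow> letter list) \<Rightarrow> bool" where
  "settles m X \<longleftrightarrow> (\<forall>l. \<exists>g. g \<in> carrier (free_group m) \<and> length g = l \<and>
     (\<exists>N. \<forall>k\<ge>N. take l (X k) = g))"

lemma settlesI:
  assumes "\<xi> \<in> boundary m" "converges_to X \<xi>"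
  shows "settles m X"
  unfolding settles_def
proof
  fix l
  have "reduced (map \<xi> [0..<l])" "fst ` set (map \<xi> [0..<l]) \<subseteq> {1..m}"
    using assms(1) by (auto simp: reduced_def successively_conv_nth boundary_def)
  then show "\<exists>g. g \<in> carrier (free_group m) \<and> length g = l \<and> (\<exists>N. \<forall>k\<ge>N. take l (X k) = g)"
    using assms(2)
    by (intro exI[of _ "map \<xi> [0..<l]"])
       (auto simp: carrier_free_group converges_to_def eventually_sequentially)
qed

lemma settlesD:
  assumes "settles m X"
  obtains \<xi> where "\<xi> \<in> boundary m" "converges_to X \<xi>"
proof -
  obtain g where carr: "\<And>l. g l \<in> carrier (free_group m)" and len: "\<And>l. length (g l) = l"
    and ev: "\<And>l. \<exists>N. \<forall>k\<ge>N. take l (X k) = g l"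
    using assms unfolding settles_def by metis
  define \<xi> where "\<xi> = (\<lambda>j. g (Suc j) ! j)"
  have nth: "g l ! j = \<xi> j" if "j < l" for l j
  proof -
    obtain N M where "\<forall>k\<ge>N. take l (X k) = g l" "\<forall>k\<ge>M. take (Suc j) (X k) = g (Suc j)"
      using ev[of l] ev[of "Suc j"] by blast
    then have "take l (X (max N M)) = g l" "take (Suc j) (X (max N M)) = g (Suc j)" by auto
    then show ?thesis
      unfolding \<xi>_def using that by (metis lessI nth_take)
  qed
  have map: "map \<xi> [0..<l] = g l" for l
    by (rule nth_equalityI) (auto simp: len nth)
  have "\<xi> \<in> boundary m"
    unfolding boundary_def
  proof (intro CollectI allI conjI)
    fix k
    have "\<xi> k \<in> set (g (Suc k))"
      using nth[of k "Suc k"] len[of "Suc k"] by (metis lessI nth_mem)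
    then show "fst (\<xi> k) \<in> {1..m}"
      using carr[of "Suc k"] by (auto simp: carrier_free_group)
    have "g (Suc (Suc k)) ! Suc k \<noteq> inv_letter (g (Suc (Suc k)) ! k)"
      using carr[of "Suc (Suc k)"] len[of "Suc (Suc k)"]
      by (auto simp: carrier_free_group reduced_def dest: successively_nth)
    then show "\<xi> (Suc k) \<noteq> inv_letter (\<xi> k)" by (simp add: nth)
  qed
  moreover have "converges_to X \<xi>"
    using ev by (simp add: converges_to_def map eventually_sequentially)
  ultimately show thesis by (rule that)
qed

lemma converges_to_unique:
  assumes "converges_to X \<xi>" "converges_to X \<zeta>"
  shows "\<xi> = \<zeta>"
proof
  fix j
  have "\<forall>\<^sub>F k in sequentially. take (Suc j) (X k) = map \<xi> [0..<Suc j] \<and>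
      take (Suc j) (X k) = map \<zeta> [0..<Suc j]"
    using assms unfolding converges_to_def by (intro eventually_conj) blast+
  then have "map \<xi> [0..<Suc j] = map \<zeta> [0..<Suc j]"
    by (auto simp: eventually_sequentially)
  then show "\<xi> j = \<zeta> j" by simp
qed

lemma limit_point_eq:
  assumes "\<xi> \<in> boundary m" "converges_to X \<xi>"
  shows "limit_point m X = \<xi>"
proof -
  have "(THE \<xi>. \<xi> \<in> boundary m \<and> converges_to X \<xi>) = \<xi>"
    using assms converges_to_unique by (intro the_equality) blast+
  then show ?thesis using assms unfolding limit_point_def by auto
qed

lemma limit_point_cylinder_iff:
  assumes "settles m X"
  shows "limit_point m X \<in> cylinder m g \<longleftrightarrow> (\<exists>N. \<forall>k\<ge>N. take (length g) (X k) = g)"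
proof -
  obtain \<xi> where \<xi>: "\<xi> \<in> boundary m" "converges_to X \<xi>"
    using settlesD[OF assms] .
  then obtain N where N: "\<forall>k\<ge>N. take (length g) (X k) = map \<xi> [0..<length g]"
    unfolding converges_to_def eventually_sequentially by blast
  have "limit_point m X \<in> cylinder m g \<longleftrightarrow> map \<xi> [0..<length g] = g"
    using \<xi> by (simp add: limit_point_eq cylinder_def)
  also have "\<dots> \<longleftrightarrow> (\<exists>N. \<forall>k\<ge>N. take (length g) (X k) = g)"
  proof
    assume "\<exists>N. \<forall>k\<ge>N. take (length g) (X k) = g"
    then obtain M where "\<forall>k\<ge>M. take (length g) (X k) = g" by blast
    then have "take (length g) (X (max N M)) = g" by simp
    moreover have "take (length g) (X (max N M)) = map \<xi> [0..<length g]" using N by simp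
    ultimately show "map \<xi> [0..<length g] = g" by simp
  qed (use N in auto)
  finally show ?thesis .
qed

lemma limit_point_default: "\<not> settles m X \<Longrightarrow> limit_point m X = (\<lambda>_. (1, True))"
  using settlesI by (auto simp: limit_point_def)

lemma limit_point_boundary:
  assumes "1 \<le> m"
  shows "limit_point m X \<in> boundary m"
proof (cases "settles m X")
  case True
  then show ?thesis using settlesD limit_point_eq by metis
next
  case False
  then show ?thesis using assms by (simp add: limit_point_default boundary_def inv_letter_def)
qed

lemma pred_limit_point_cylinder:
  "Measurable.pred (steps \<mu>) (\<lambda>s. limit_point m (walk m x s) \<in> cylinder m g)"
proof -
  have "(\<lambda>s. limit_point m (walk m x s) \<in> cylinder m g) =
    (\<lambda>s. (settles m (walk m x s) \<and> (\<exists>N. \<forall>k\<ge>N. take (length g) (walk m x s k) = g)) \<or>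
       (\<not> settles m (walk m x s) \<and> (\<lambda>_. (1, True)) \<in> cylinder m g))"
    (is "_ = ?Q")
  proof
    fix s
    show "limit_point m (walk m x s) \<in> cylinder m g \<longleftrightarrow> ?Q s"
      by (cases "settles m (walk m x s)") (simp_all add: limit_point_cylinder_iff limit_point_default)
  qed
  also have "Measurable.pred (steps \<mu>) \<dots>"
    unfolding settles_def by (intro path_event)
  finally show ?thesis .
qed

lemma limit_point_measurable:
  assumes "1 \<le> m"
  shows "(\<lambda>s. limit_point m (walk m x s)) \<in> measurable (steps \<mu>) (boundary_algebra m)"
  unfolding boundary_algebra_def
proof (rule measurable_measure_of)
  show "cylinder m ` carrier (free_group m) \<subseteq> Pow (boundary m)"
    by (auto simp: cylinder_def)
  show "(\<lambda>s. limit_point m (walk m x s)) \<in> space (steps \<mu>) \<rightarrow> boundary m"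
    using limit_point_boundary[OF assms] by auto
  fix Y assume "Y \<in> cylinder m ` carrier (free_group m)"
  then obtain g where Y: "Y = cylinder m g" by blast
  show "(\<lambda>s. limit_point m (walk m x s)) -` Y \<inter> space (steps \<mu>) \<in> sets (steps \<mu>)"
    using pred_sets_steps[OF pred_limit_point_cylinder] by (simp add: Y vimage_def)
qed

lemma hitting_measure_cylinder:
  assumes "1 \<le> m" "g \<in> carrier (free_group m)"
  shows "measure (hitting_measure m \<mu>) (cylinder m g) =
    pr \<mu> (\<lambda>s. limit_point m (walk m [] s) \<in> cylinder m g)"
proof -
  have "cylinder m g \<in> sets (boundary_algebra m)"
    unfolding boundary_algebra_def using assms(2)
    by (subst sets_measure_of) (auto simp: cylinder_def)
  then show ?thesis
    unfolding hitting_measure_def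
    by (simp add: measure_distr[OF limit_point_measurable[OF assms(1)]] vimage_def)
qed

context power_walk
begin

text \<open>Balls in the group are finite, so a path that leaves every point leaves every ball. Once its words have
  length at least \<open>l + n\<close>, no step can change the first \<open>l\<close> letters.\<close>

lemma walk_settles:
  assumes s: "\<forall>k. s k \<in> set_pmf \<mu>"
    and esc: "\<forall>g. g \<in> carrier (free_group m) \<longrightarrow> \<not> (\<forall>N. \<exists>t\<ge>N. W s t = g)"
  shows "settles m (W s)"
  unfolding settles_def
proof
  fix l
  define B where "B = {w \<in> carrier (free_group m). length w \<le> l + n}"
  have "finite B"
  proof (rule finite_subset)
    show "B \<subseteq> {w. set w \<subseteq> {1..m} \<times> UNIV \<and> length w \<le> l + n}"
      by (fastforce simp: B_def carrier_free_group)
  qed (simp add: finite_lists_length_le)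
  moreover have "\<forall>g\<in>B. \<forall>\<^sub>F t in sequentially. W s t \<noteq> g"
    using esc by (auto simp: B_def eventually_sequentially)
  ultimately have "\<forall>\<^sub>F t in sequentially. \<forall>g\<in>B. W s t \<noteq> g"
    by (rule eventually_ball_finite)
  then obtain N where N: "\<And>t. t \<ge> N \<Longrightarrow> W s t \<notin> B"
    by (auto simp: eventually_sequentially)
  have long: "l + n \<le> length (W s t)" if "t \<ge> N" for t
    using N[OF that] walk_carrier[OF s, of t] by (auto simp: B_def)
  have const: "take l (W s (N + u)) = take l (W s N)" for u
  proof (induction u)
    case (Suc u)
    have "s (N + u) \<in> set_pmf \<mu>" using s by blast
    then have "reduced (s (N + u))" "length (s (N + u)) \<le> n"
      by (auto simp: support reduced_replicate)
    then have "take l (W s (N + u) \<odot> s (N + u)) = take l (W s (N + u))"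
      using long[of "N + u"] walk_reduced[OF s, of "N + u"] by (intro take_mult) auto
    then show ?case using Suc by simp
  qed simp
  have "take l (W s N) \<in> carrier (free_group m)"
  proof -
    have "reduced (take l (W s N))"
      using walk_reduced[OF s, of N] unfolding reduced_def
      by (metis append_take_drop_id successively_append_iff)
    then show ?thesis
      using walk_carrier[OF s, of N] set_take_subset[of l "W s N"]
      unfolding carrier_free_group by blast
  qed
  moreover have "length (take l (W s N)) = l" using long[of N] by simp
  moreover have "\<forall>k\<ge>N. take l (W s k) = take l (W s N)"
    using const by (metis le_add_diff_inverse)
  ultimately show "\<exists>g. g \<in> carrier (free_group m) \<and> length g = l \<and>
      (\<exists>N. \<forall>k\<ge>N. take l (W s k) = g)"
    by blast
qed

lemma AE_settles: "AE s in steps \<mu>. settles m (W s)"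
proof -
  have "AE s in steps \<mu>. \<not> (\<forall>N. \<exists>t\<ge>N. W s t = g)" if "g \<in> carrier (free_group m)" for g
    by (subst AE_not_iff_pr_eq_0) (intro path_event, rule finite_visits[OF that])
  then have "AE s in steps \<mu>. \<forall>g. g \<in> carrier (free_group m) \<longrightarrow> \<not> (\<forall>N. \<exists>t\<ge>N. W s t = g)"
    unfolding AE_all_countable by (auto simp del: not_all)
  with AE_steps show ?thesis
    by eventually_elim (rule walk_settles)
qed

lemma proj_after_last_visit:
  assumes s: "\<forall>k. s k \<in> set_pmf \<mu>" and T: "W s T \<in> axis i" "\<forall>u>T. W s u \<notin> axis i"
  shows "proj i (W s (T + u)) = W s T"
proof (induction u)
  case 0
  then show ?case using T proj_axis by simp
next
  case (Suc u)
  have "W s (Suc (T + u)) \<notin> axis i" using T(2) by (simp del: walk.simps)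
  then show ?case using proj_walk_Suc[OF s, of "T + u" i] Suc by (simp del: walk.simps)
qed

text \<open>After the last visit to the axis the walk keeps the same projection. If the words of the path
  eventually begin with \<open>a\<^sub>i\<close>, so does this projection, and a point of the axis beginning with \<open>a\<^sub>i\<close> is a
  positive power of it.\<close>

lemma last_visit_of_limit:
  assumes s: "\<forall>k. s k \<in> set_pmf \<mu>" and fin: "\<not> (\<forall>N. \<exists>t\<ge>N. W s t \<in> axis i)"
    and lim: "settles m (W s)" "limit_point m (W s) \<in> cylinder m [(i, True)]"
  shows "\<exists>j. last_visit i (replicate (Suc j) (i, True)) s"
proof -
  obtain N where N: "\<forall>t\<ge>N. W s t \<notin> axis i" using fin by blast
  define T where "T = Max {t. W s t \<in> axis i}"
  have finite: "finite {t. W s t \<in> axis i}"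
    by (rule finite_subset[of _ "{..<N}"]) (use N not_le in auto)
  have "0 \<in> {t. W s t \<in> axis i}" by simp
  then have "T \<in> {t. W s t \<in> axis i}"
    unfolding T_def using Max_in[OF finite] by blast
  moreover have "u \<le> T" if "W s u \<in> axis i" for u
    unfolding T_def using Max_ge[OF finite] that by simp
  ultimately have T: "W s T \<in> axis i" "\<forall>u>T. W s u \<notin> axis i"
    by (auto simp: not_le[symmetric])
  obtain M where M: "\<forall>k\<ge>M. take 1 (W s k) = [(i, True)]"
    using lim by (auto simp: limit_point_cylinder_iff)
  have "take 1 (W s (T + M)) = [(i, True)]" using M by simp
  then obtain w where "W s (T + M) = (i, True) # w"
    by (cases "W s (T + M)") auto
  then have hd: "W s T = (i, True) # proj i w"
    using proj_after_last_visit[OF s T, of M] by (simp add: proj_def)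
  obtain r b where rb: "W s T = replicate r (i, b)"
    using reduced_axisD[OF walk_reduced[OF s] T(1)] .
  with hd obtain j where "r = Suc j" "b = True" by (cases r) auto
  then have "last_visit i (replicate (Suc j) (i, True)) s"
    using T rb by (auto simp: last_visit_def)
  then show ?thesis ..
qed

lemma cylinder_le_last_visit:
  assumes i: "i \<in> {1..m}"
  shows "measure (hitting_measure m \<mu>) (cylinder m [(i, True)])
    \<le> pr \<mu> (\<lambda>s. \<exists>j. last_visit i (replicate (Suc j) (i, True)) s)"
proof -
  interpret prob_space "steps \<mu>" by (rule prob_space_steps)
  have "AE s in steps \<mu>. \<not> (\<forall>N. \<exists>t\<ge>N. W s t \<in> axis i)"
    by (subst AE_not_iff_pr_eq_0) (intro path_event, rule finite_visits_axis[OF i])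
  with AE_settles AE_steps
  have "AE s in steps \<mu>. s \<in> {s. limit_point m (W s) \<in> cylinder m [(i, True)]} \<longrightarrow>
      s \<in> {s. \<exists>j. last_visit i (replicate (Suc j) (i, True)) s}"
    by eventually_elim (use last_visit_of_limit in blast)
  then have "pr \<mu> (\<lambda>s. limit_point m (W s) \<in> cylinder m [(i, True)])
      \<le> pr \<mu> (\<lambda>s. \<exists>j. last_visit i (replicate (Suc j) (i, True)) s)"
    by (rule finite_measure_mono_AE)
       (intro pred_sets_steps pred_intros_countable pred_last_visit)
  moreover have "[(i, True)] \<in> carrier (free_group m)"
    using replicate_carrier[of "(i, True)" m 1] i by simp
  ultimately show ?thesis
    using i by (simp add: hitting_measure_cylinder)
qed

lemma last_visit_sums:
  "(\<lambda>j. F (replicate (Suc j) (i, True)) * pr \<mu> (last_visit i [])) sums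
     pr \<mu> (\<lambda>s. \<exists>j. last_visit i (replicate (Suc j) (i, True)) s)"
proof -
  have "(\<lambda>j. pr \<mu> (last_visit i (replicate (Suc j) (i, True)))) sums
     pr \<mu> (\<lambda>s. \<exists>j. last_visit i (replicate (Suc j) (i, True)) s)"
  proof (rule sums_pr)
    fix s j k
    assume "last_visit i (replicate (Suc j) (i, True)) s" "last_visit i (replicate (Suc k) (i, True)) s"
    then have "replicate (Suc j) (i, True) = replicate (Suc k) (i, True)"
      by (rule last_visit_unique[OF _ _ replicate_axis replicate_axis])
    then show "j = k" by (metis Suc_inject length_replicate)
  qed (rule pred_last_visit)
  moreover have "pr \<mu> (last_visit i (replicate (Suc j) (i, True))) =
      F (replicate (Suc j) (i, True)) * pr \<mu> (last_visit i [])" for j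
    by (rule pr_last_visit) (rule reduced_replicate, rule replicate_axis)
  ultimately show ?thesis by simp
qed

text \<open>Last visits at positive powers, at negative powers and at the identity exclude one another, and \<open>flip\<close>
  exchanges the first two.\<close>

lemma last_visit_total:
  "2 * pr \<mu> (\<lambda>s. \<exists>j. last_visit i (replicate (Suc j) (i, True)) s) + pr \<mu> (last_visit i []) \<le> 1"
proof -
  let ?E = "\<lambda>b s. \<exists>j. last_visit i (replicate (Suc j) (i, b)) s"
  have E: "Measurable.pred (steps \<mu>) (?E b)" for b
    by (intro pred_intros_countable pred_last_visit)
  have flip: "last_visit i (flip y) (\<lambda>k. flip (s k)) = last_visit i y s" for y s
    by (simp only: last_visit_def walk_flip flip_eq_iff flip_flip flip_axis)
  have "pr \<mu> (?E False) = pr \<mu> (\<lambda>s. ?E False (\<lambda>k. flip (s k)))"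
    by (rule pr_flip[symmetric]) (rule E)
  also have "\<dots> = pr \<mu> (?E True)"
  proof -
    have "replicate j (i, False) = flip (replicate j (i, True))" for j
      by (simp add: inv_letter_def)
    then show ?thesis by (simp only: flip)
  qed
  finally have sym: "pr \<mu> (?E False) = pr \<mu> (?E True)" .
  have disj: "\<not> (?E True s \<and> ?E False s)" "\<not> ((?E True s \<or> ?E False s) \<and> last_visit i [] s)" for s
  proof -
    have "replicate (Suc j) (i, True) \<noteq> replicate (Suc k) (i, False)" for j k by simp
    then show "\<not> (?E True s \<and> ?E False s)"
      using last_visit_unique[OF _ _ replicate_axis replicate_axis] by blast
    have "replicate (Suc j) (i, b) \<noteq> []" for j and b :: bool by simp
    then show "\<not> ((?E True s \<or> ?E False s) \<and> last_visit i [] s)"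
      using last_visit_unique[OF _ _ replicate_axis Nil_axis] by blast
  qed
  have "pr \<mu> (?E True) + pr \<mu> (?E False) + pr \<mu> (last_visit i []) =
      pr \<mu> (\<lambda>s. ?E True s \<or> ?E False s) + pr \<mu> (last_visit i [])"
    using E disj(1) by (subst pr_disjoint) auto
  also have "\<dots> = pr \<mu> (\<lambda>s. (?E True s \<or> ?E False s) \<or> last_visit i [] s)"
    using E disj(2) by (intro pr_disjoint[symmetric] pred_intros_logic pred_last_visit) auto
  also have "\<dots> \<le> 1" by (rule pr_le_1)
  finally show ?thesis using sym by simp
qed

end

section \<open>Exponential decay of first passages and the odds of a cylinder\<close>

text \<open>Half of Fekete's lemma. With \<open>x\<close> the \<open>N\<close>-th root of \<open>f N\<close>, division of \<open>k\<close> by \<open>N\<close> with remainder gives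
  \<open>x\<^sup>k d \<le> f k\<close> for a constant \<open>d > 0\<close> that bounds the values at the remainders, and the \<open>k\<close>-th root of
  \<open>d\<close> tends to one.\<close>

lemma root_le_liminf_root:
  fixes f :: "nat \<Rightarrow> real"
  assumes super: "\<And>j k. f j * f k \<le> f (j + k)" and "f 0 = 1" and pos: "0 < f 1"
    and le_1: "\<And>k. f k \<le> 1" and N: "1 \<le> N"
  shows "ereal (root N (f N)) \<le> liminf (\<lambda>k. ereal (root k (f k)))"
proof -
  have pow: "f j ^ q \<le> f (j * q)" if "0 \<le> f j" for j q
  proof (induction q)
    case (Suc q)
    have "f j ^ Suc q \<le> f j * f (j * q)" using Suc that by (simp add: mult_left_mono)
    also have "\<dots> \<le> f (j * Suc q)" using super[of j "j * q"] by simp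
    finally show ?case .
  qed (use assms in simp)
  have f_pos: "0 < f k" for k
    using pow[of 1 k] pos by (metis less_le_trans less_imp_le mult_1 zero_less_power)
  define x where "x = root N (f N)"
  have x: "0 < x" "x \<le> 1" "x ^ N = f N"
    using N f_pos[of N] le_1[of N] by (auto simp: x_def)
  define d where "d = f 1 ^ N"
  have d: "0 < d" using pos by (simp add: d_def)
  have lower: "x ^ k * d \<le> f k" for k
  proof -
    have "x ^ k \<le> x ^ (N * (k div N))"
      using x by (intro power_decreasing) auto
    also have "\<dots> = f N ^ (k div N)" by (simp add: power_mult x)
    also have "\<dots> \<le> f (N * (k div N))" using f_pos less_imp_le by (intro pow) auto
    finally have 1: "x ^ k \<le> f (N * (k div N))" .
    have "d \<le> f 1 ^ (k mod N)"
      unfolding d_def using pos le_1[of 1] N by (intro power_decreasing) (auto intro: less_imp_le)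
    also have "\<dots> \<le> f (k mod N)" using pow[of 1 "k mod N"] pos by simp
    finally have 2: "d \<le> f (k mod N)" .
    have "x ^ k * d \<le> f (N * (k div N)) * f (k mod N)"
      using 1 2 x d f_pos less_imp_le by (intro mult_mono) auto
    also have "\<dots> \<le> f k" using super[of "N * (k div N)" "k mod N"] by simp
    finally show ?thesis .
  qed
  have "(\<lambda>k. x * root k d) \<longlonglongrightarrow> x * 1"
    by (intro tendsto_intros LIMSEQ_root_const d)
  then have "(\<lambda>k. ereal (x * root k d)) \<longlonglongrightarrow> ereal x" by simp
  then have "ereal x = liminf (\<lambda>k. ereal (x * root k d))"
    by (rule lim_imp_Liminf[OF sequentially_bot, symmetric])
  also have "\<dots> \<le> liminf (\<lambda>k. ereal (root k (f k)))"
  proof (rule Liminf_mono)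
    show "\<forall>\<^sub>F k in sequentially. ereal (x * root k d) \<le> ereal (root k (f k))"
      using eventually_gt_at_top[of 0]
    proof eventually_elim
      case (elim k)
      have "x * root k d = root k (x ^ k * d)"
        using elim x by (simp add: real_root_mult real_root_power_cancel)
      also have "\<dots> \<le> root k (f k)" using elim lower by simp
      finally show ?case by simp
    qed
  qed
  finally show ?thesis by (simp add: x_def)
qed

text \<open>Here \<open>K\<close> and \<open>q\<close> stand for the probabilities that the last visit to the axis is at the identity and at
  a positive power. If \<open>\<rho> = r < 1\<close>, the geometric series gives \<open>q (1 - r) \<le> r K\<close>; adding
  \<open>2 r q + r K \<le> r\<close> yields \<open>q (1 + r) \<le> r\<close>. If \<open>\<rho> \<ge> 1\<close>, then \<open>q \<le> 1/2\<close> is enough.\<close>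

lemma odds_le_of_geometric_bound:
  fixes f :: "nat \<Rightarrow> real" and \<rho> :: ereal
  assumes sums: "(\<lambda>j. f (Suc j) * K) sums q" and K: "0 < K" and total: "2 * q + K \<le> 1"
    and p: "p \<le> q" and f: "\<And>j. 0 \<le> f (Suc j)" and root: "\<And>j. ereal (root (Suc j) (f (Suc j))) \<le> \<rho>"
  shows "ereal (p / (1 - p)) \<le> \<rho>"
proof (cases "\<rho> \<ge> 1")
  case True
  have "p \<le> 1 / 2" using p total K by linarith
  then have "p / (1 - p) \<le> 1" by (simp add: field_simps)
  then have "ereal (p / (1 - p)) \<le> 1" by (simp add: one_ereal_def)
  with True show ?thesis by (rule order_trans[rotated])
next
  case False
  have "0 \<le> ereal (root (Suc 0) (f (Suc 0)))" using f[of 0] by simp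
  also have "\<dots> \<le> \<rho>" by (rule root)
  finally have "0 \<le> \<rho>" .
  with False obtain r where r: "\<rho> = ereal r" "0 \<le> r" "r < 1"
    by (cases \<rho>) auto
  have geom: "f (Suc j) \<le> r * r ^ j" for j
  proof -
    have "f (Suc j) = root (Suc j) (f (Suc j)) ^ Suc j"
      using f[of j] by (simp only: real_root_pow_pos2)
    also have "\<dots> \<le> r ^ Suc j"
      using root[of j] r f[of j] by (intro power_mono) (auto simp: real_root_ge_zero)
    finally show ?thesis by simp
  qed
  have "(\<lambda>j. (r * r ^ j) * K) sums (r * (1 / (1 - r)) * K)"
    using r by (intro sums_mult2 sums_mult geometric_sums) auto
  then have "q \<le> r * (1 / (1 - r)) * K"
    using sums geom K by (elim sums_le[rotated]) (auto intro: mult_right_mono)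
  then have "q * (1 - r) \<le> r * K" using r by (simp add: field_simps)
  moreover have "r * (2 * q + K) \<le> r * 1" using total r by (intro mult_left_mono) auto
  ultimately have "q * (1 + r) \<le> r" by (simp add: algebra_simps)
  moreover have "p * (1 + r) \<le> q * (1 + r)" using p r by (intro mult_right_mono) auto
  ultimately have "p * (1 + r) \<le> r" by linarith
  moreover have "p < 1" using p total K by linarith
  ultimately have "p / (1 - p) \<le> r" by (simp add: field_simps)
  then show ?thesis by (simp add: r)
qed

theorem theorem1p1:
  fixes m n i :: nat and \<mu> :: "letter list pmf"
  assumes "n \<ge> 1"
    and symmetric: "\<And>g. g \<in> carrier (free_group m) \<Longrightarrow> pmf \<mu> (inv\<^bsub>free_group m\<^esub> g) = pmf \<mu> g"
    and support: "set_pmf \<mu> =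
      {gen i [^]\<^bsub>free_group m\<^esub> j | (i::nat) (j::int). 1 \<le> i \<and> i \<le> m \<and> 1 \<le> \<bar>j\<bar> \<and> \<bar>j\<bar> \<le> int n}"
    and transient: "transient m \<mu>"
    and "1 \<le> i" and "i \<le> m"
  shows "rho m \<mu> (gen i) \<ge>
    ereal (measure (hitting_measure m \<mu>) (cylinder m (gen i)) /
           (1 - measure (hitting_measure m \<mu>) (cylinder m (gen i))))"
proof -
  interpret power_walk m n \<mu>
    using assms(1-4) by (rule power_walkI)
  define f where "f k = F (replicate k (i, True))" for k
  have i: "i \<in> {1..m}" using assms by simp
  have mult: "replicate j (i, True) \<odot> replicate k (i, True) = replicate (j + k) (i, True)" for j k
  proof -
    have "gen i \<in> carrier (free_group m)"
      using replicate_carrier[of "(i, True)" m 1] i by (simp add: gen_def)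
    from monoid.nat_pow_mult[OF group.is_monoid[OF group_free_group] this, of j k]
    show ?thesis by (simp only: gen_pow mult_free_group)
  qed
  have super: "f j * f k \<le> f (j + k)" for j k
    using F_supermultiplicative[of "replicate j (i, True)" "replicate k (i, True)"]
    unfolding f_def mult .
  have f0: "f 0 = 1"
  proof -
    have "\<exists>t. W s t = []" for s by (rule exI[of _ 0]) simp
    then show ?thesis using pr_True[of \<mu>] by (simp add: f_def)
  qed
  have f1: "0 < f 1"
  proof -
    have "[(i, True)] \<in> set_pmf \<mu>"
      unfolding power_walk.support[OF power_walk_axioms] using i n_pos
      by (intro CollectI exI[of _ 1] exI[of _ "(i, True)"]) simp
    then have "0 < pmf \<mu> [(i, True)]" by (rule pmf_positive)
    also have "\<dots> = pr \<mu> (\<lambda>s. s 0 = [(i, True)])" by (rule step_prob[symmetric])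
    also have "\<dots> \<le> f 1"
      unfolding f_def
    proof (rule pr_mono)
      show "\<exists>t. W s t = replicate 1 (i, True)" if "s 0 = [(i, True)]" for s
        using that by (intro exI[of _ 1]) (simp add: cons_red_def)
    qed (intro path_event)
    finally show ?thesis .
  qed
  have rho: "rho m \<mu> (gen i) = liminf (\<lambda>k. ereal (root k (f k)))"
    by (simp add: rho_def gen_pow first_passage_eq f_def)
  show ?thesis
  proof (rule odds_le_of_geometric_bound[where f = f])
    show "(\<lambda>j. f (Suc j) * pr \<mu> (last_visit i [])) sums
        pr \<mu> (\<lambda>s. \<exists>j. last_visit i (replicate (Suc j) (i, True)) s)"
      unfolding f_def by (rule last_visit_sums)
    show "0 < pr \<mu> (last_visit i [])" by (rule last_visit_Nil_pos[OF i])
    show "2 * pr \<mu> (\<lambda>s. \<exists>j. last_visit i (replicate (Suc j) (i, True)) s) + pr \<mu> (last_visit i []) \<le> 1"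
      by (rule last_visit_total)
    show "measure (hitting_measure m \<mu>) (cylinder m (gen i))
        \<le> pr \<mu> (\<lambda>s. \<exists>j. last_visit i (replicate (Suc j) (i, True)) s)"
      unfolding gen_def by (rule cylinder_le_last_visit[OF i])
    show "0 \<le> f (Suc j)" for j by (simp add: f_def)
    show "ereal (root (Suc j) (f (Suc j))) \<le> rho m \<mu> (gen i)" for j
      unfolding rho using super f0 f1 by (rule root_le_liminf_root) (simp_all add: f_def pr_le_1)
  qed
qed

end
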